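(* Let $d\ge1$, let $\Psi\in\mathcal B_0$ be unbounded and satisfy: for every $\gamma_0>0$, $$\lim_{s\to0}\ \sup_{\gamma\in[\gamma_0,\infty)}\frac{\Psi(s\gamma)}{\Psi(\gamma)}=0 .$$ Let $\mathcal K\subset\mathbb R^d$ be a bounded convex set with non-empty interior. Then there exist constants $\varrho_1,\varrho_2>0$, depending only on $\Psi$ and $\operatorname{inrad}\mathcal K$, such that the following holds. Let $v>0$, $V=-v\mathbf 1_{\mathcal K}$, let $\varphi\not\equiv0$ be a solution in $L^2(\mathbb R^d)$ of $(\Psi(-\Delta)+V)\varphi=\lambda\varphi$ with eigenvalue $\lambda=-|\lambda|<0$, and let $x^*$ be a location of a global maximum of $|\varphi|$. If $$\frac{v-|\lambda|}{|\lambda|}\ \le\ \varrho_1 ,$$ then $x^*\in\operatorname{Int}\mathcal K$ and $$\operatorname{dist}(x^*,\partial\mathcal K)\ \ge\ \frac{1}{\sqrt{\Psi^{-1}\big(|\lambda|/\varrho_2\big)}} .$$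
   Context: $\mathcal B_0$ is the set of Bernstein functions vanishing at zero: $f\in C^\infty((0,\infty))$, $f\ge0$, $(-1)^n f^{(n)}\le 0$ for all $n\ge1$, and $\lim_{u\downarrow0}f(u)=0$. $\Psi(-\Delta)$ is the operator with Fourier multiplier $\Psi(|y|^2)$. Let $(S^\Psi_t)_{t\ge0}$ be the subordinator with $\mathbb E[e^{-uS^\Psi_t}]=e^{-t\Psi(u)}$, $(B_t)_{t\ge0}$ an independent $d$-dimensional Brownian motion running twice as fast as standard Brownian motion, and $X_t=B_{S^\Psi_t}$; $\mathbb E^x$ is expectation for $X$ started at $x$. Eigenfunctions are bounded continuous functions $\varphi\in L^2(\mathbb R^d)$ satisfying the Feynman-Kac representation $\varphi(x)=e^{\lambda t}\,\mathbb E^x\big[e^{-\int_0^tV(X_s)ds}\varphi(X_t)\big]$ for all $x\in\mathbb R^d$, $t\ge0$. $\operatorname{Int}\mathcal K$ is the interior and $\operatorname{inrad}\mathcal K$ the inradius of $\mathcal K$. *)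

theory Defs
  imports "HOL-Probability.Probability"
begin

text \<open>The constants of the theorem must not depend on the dimension, so \<open>d\<close> has to be a
  number and not a type. \<open>\<real>\<^sup>d\<close> is therefore the library's space
  \<^const>\<open>Euclidean_space\<close> \<open>d\<close>: the sequences \<open>x :: nat \<Rightarrow> real\<close> with \<open>x i = 0\<close> for all \<open>i \<ge> d\<close>.
  Interior, boundary and continuity are those of this topology; functions on \<open>\<real>\<^sup>d\<close> are only
  ever evaluated at points of its carrier.\<close>

abbreviation Rd :: "nat \<Rightarrow> (nat \<Rightarrow> real) set" where
  "Rd d \<equiv> topspace (Euclidean_space d)"

definition dist_Rd :: "nat \<Rightarrow> (nat \<Rightarrow> real) \<Rightarrow> (nat \<Rightarrow> real) \<Rightarrow> real" where
  "dist_Rd d x y = L2_set (\<lambda>i. x i - y i) {..<d}"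

definition ball_Rd :: "nat \<Rightarrow> (nat \<Rightarrow> real) \<Rightarrow> real \<Rightarrow> (nat \<Rightarrow> real) set" where
  "ball_Rd d c r = {x \<in> Rd d. dist_Rd d c x < r}"

definition bounded_Rd :: "nat \<Rightarrow> (nat \<Rightarrow> real) set \<Rightarrow> bool" where
  "bounded_Rd d A \<longleftrightarrow> (\<exists>c\<in>Rd d. \<exists>r. \<forall>x\<in>A. dist_Rd d c x \<le> r)"

definition convex_seq :: "(nat \<Rightarrow> real) set \<Rightarrow> bool" where
  "convex_seq A \<longleftrightarrow> (\<forall>x\<in>A. \<forall>y\<in>A. \<forall>u\<in>{0..1}. (\<lambda>i. (1 - u) * x i + u * y i) \<in> A)"

definition inrad :: "nat \<Rightarrow> (nat \<Rightarrow> real) set \<Rightarrow> real" where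
  "inrad d A = Sup {r. 0 \<le> r \<and> (\<exists>c\<in>Rd d. ball_Rd d c r \<subseteq> A)}"

definition dist_boundary :: "nat \<Rightarrow> (nat \<Rightarrow> real) \<Rightarrow> (nat \<Rightarrow> real) set \<Rightarrow> real" where
  "dist_boundary d x A = (INF z\<in>Euclidean_space d frontier_of A. dist_Rd d x z)"

text \<open>Points of the product space \<open>\<Pi>\<^sub>M i\<in>{..<d}. lborel\<close> are \<^const>\<open>undefined\<close> at \<open>i \<ge> d\<close>;
  they are turned into points of \<open>Rd d\<close> before \<open>\<phi>\<close> is applied.\<close>

definition square_integrable :: "nat \<Rightarrow> ((nat \<Rightarrow> real) \<Rightarrow> complex) \<Rightarrow> bool" where
  "square_integrable d \<phi> \<longleftrightarrow>
     integrable (\<Pi>\<^sub>M i\<in>{..<d}. lborel) (\<lambda>y. (cmod (\<phi> (\<lambda>i. if i < d then y i else 0)))\<^sup>2)"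

text \<open>Members of \<open>bernstein0\<close> are functions on \<open>(0,\<infinity>)\<close>; their values on \<open>(-\<infinity>,0]\<close> are
  irrelevant.\<close>

definition bernstein0 :: "(real \<Rightarrow> real) set" where
  "bernstein0 = {f.
     (\<forall>n. \<forall>u>0. (deriv ^^ n) f differentiable (at u)) \<and>
     (\<forall>u>0. 0 \<le> f u) \<and>
     (\<forall>n\<ge>1. \<forall>u>0. (-1) ^ n * (deriv ^^ n) f u \<le> 0) \<and>
     (f \<longlongrightarrow> 0) (at_right 0)}"

definition indep_increments :: "'w measure \<Rightarrow> (real \<Rightarrow> 'w \<Rightarrow> real) \<Rightarrow> bool" where
  "indep_increments M Z \<longleftrightarrow>
     (\<forall>n \<tau>. 0 \<le> \<tau> 0 \<and> (\<forall>k<n. \<tau> k \<le> \<tau> (Suc k)) \<longrightarrow>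
        prob_space.indep_vars M (\<lambda>_. borel) (\<lambda>k \<omega>. Z (\<tau> (Suc k)) \<omega> - Z (\<tau> k) \<omega>) {..<n::nat})"

text \<open>Path properties are required for every \<open>\<omega>\<close>; the usual almost sure version differs from
  this only by a modification on a null set. Time parameters range over \<open>[0,\<infinity>)\<close>.\<close>

definition subordinator :: "'w measure \<Rightarrow> (real \<Rightarrow> real) \<Rightarrow> (real \<Rightarrow> 'w \<Rightarrow> real) \<Rightarrow> bool" where
  "subordinator M \<Psi> S \<longleftrightarrow>
     prob_space M \<and>
     (\<forall>t\<ge>0. S t \<in> borel_measurable M) \<and>
     (\<forall>\<omega>\<in>space M. S 0 \<omega> = 0 \<and> mono_on {0..} (\<lambda>t. S t \<omega>) \<and>
        (\<forall>t\<ge>0. continuous (at_right t) (\<lambda>t. S t \<omega>))) \<and>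
     indep_increments M S \<and>
     (\<forall>s\<ge>0. \<forall>t\<ge>0. distr M borel (\<lambda>\<omega>. S (s + t) \<omega> - S s \<omega>) = distr M borel (S t)) \<and>
     (\<forall>t\<ge>0. \<forall>u>0. (\<integral>\<omega>. exp (- u * S t \<omega>) \<partial>M) = exp (- t * \<Psi> u))"

text \<open>The increment over \<open>[s,t]\<close> has variance \<open>2 (t - s)\<close>: twice standard speed, so that the
  generator is \<open>\<Delta>\<close>.\<close>

definition brownian1 :: "'w measure \<Rightarrow> (real \<Rightarrow> 'w \<Rightarrow> real) \<Rightarrow> bool" where
  "brownian1 M \<beta> \<longleftrightarrow>
     prob_space M \<and>
     (\<forall>t\<ge>0. \<beta> t \<in> borel_measurable M) \<and>
     (\<forall>\<omega>\<in>space M. \<beta> 0 \<omega> = 0 \<and> continuous_on {0..} (\<lambda>t. \<beta> t \<omega>)) \<and>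
     indep_increments M \<beta> \<and>
     (\<forall>s\<ge>0. \<forall>t>s. distributed M lborel (\<lambda>\<omega>. \<beta> t \<omega> - \<beta> s \<omega>)
        (\<lambda>x. ennreal (normal_density 0 (sqrt (2 * (t - s))) x)))"

definition brownian :: "'w measure \<Rightarrow> nat \<Rightarrow> (real \<Rightarrow> 'w \<Rightarrow> nat \<Rightarrow> real) \<Rightarrow> bool" where
  "brownian M d B \<longleftrightarrow>
     prob_space M \<and>
     (\<forall>t\<ge>0. \<forall>\<omega>\<in>space M. B t \<omega> \<in> Rd d) \<and>
     (\<forall>i<d. brownian1 M (\<lambda>t \<omega>. B t \<omega> i)) \<and>
     prob_space.indep_vars M (\<lambda>_. \<Pi>\<^sub>M t\<in>{0..}. borel) (\<lambda>i \<omega>. \<lambda>t\<in>{0..}. B t \<omega> i) {..<d}"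

definition indep_processes ::
  "'w measure \<Rightarrow> nat \<Rightarrow> (real \<Rightarrow> 'w \<Rightarrow> real) \<Rightarrow> (real \<Rightarrow> 'w \<Rightarrow> nat \<Rightarrow> real) \<Rightarrow> bool" where
  "indep_processes M d S B \<longleftrightarrow>
     prob_space.indep_set M
       (sets (vimage_algebra (space M) (\<lambda>\<omega>. \<lambda>t\<in>{0..}. S t \<omega>)
          (\<Pi>\<^sub>M t\<in>{0..}. borel)))
       (sets (vimage_algebra (space M) (\<lambda>\<omega>. \<lambda>p\<in>{..<d} \<times> {0..}. B (snd p) \<omega> (fst p))
          (\<Pi>\<^sub>M p\<in>{..<d} \<times> {0..}. borel)))"

definition subordinate_BM_setup ::
  "'w measure \<Rightarrow> nat \<Rightarrow> (real \<Rightarrow> real) \<Rightarrow> (real \<Rightarrow> 'w \<Rightarrow> real) \<Rightarrow>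
   (real \<Rightarrow> 'w \<Rightarrow> nat \<Rightarrow> real) \<Rightarrow> bool" where
  "subordinate_BM_setup M d \<Psi> S B \<longleftrightarrow>
     subordinator M \<Psi> S \<and> brownian M d B \<and> indep_processes M d S B"

text \<open>\<open>X\<^sub>t = B\<^bsub>S\<^sub>t\<^esub>\<close> started at \<open>x\<close>.\<close>

definition subordinate_BM ::
  "(real \<Rightarrow> 'w \<Rightarrow> real) \<Rightarrow> (real \<Rightarrow> 'w \<Rightarrow> nat \<Rightarrow> real) \<Rightarrow> (nat \<Rightarrow> real) \<Rightarrow>
   real \<Rightarrow> 'w \<Rightarrow> nat \<Rightarrow> real" where
  "subordinate_BM S B x t \<omega> = (\<lambda>i. x i + B (S t \<omega>) \<omega> i)"

text \<open>Eigenfunctions of \<open>\<Psi>(-\<Delta>) + V\<close>, the generator being that of the process above.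
  A bounded convex \<open>K\<close> need not be Borel, so for \<open>V = -v 1\<^sub>K\<close> the Feynman-Kac functional is
  in general measurable only up to null sets. Hence the time integral is the gauge integral,
  which ignores null sets of times, and the expectation is taken on the completion of \<open>M\<close>,
  which does not affect it for \<open>M\<close>-measurable functionals.\<close>

definition eigenfunction ::
  "'w measure \<Rightarrow> nat \<Rightarrow> (real \<Rightarrow> 'w \<Rightarrow> real) \<Rightarrow> (real \<Rightarrow> 'w \<Rightarrow> nat \<Rightarrow> real) \<Rightarrow>
   ((nat \<Rightarrow> real) \<Rightarrow> real) \<Rightarrow> real \<Rightarrow> ((nat \<Rightarrow> real) \<Rightarrow> complex) \<Rightarrow> bool" where
  "eigenfunction M d S B V lam \<phi> \<longleftrightarrow>
     continuous_map (Euclidean_space d) euclidean \<phi> \<and>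
     bounded (\<phi> ` Rd d) \<and>
     square_integrable d \<phi> \<and>
     (\<exists>x\<in>Rd d. \<phi> x \<noteq> 0) \<and>
     (\<forall>x\<in>Rd d. \<forall>t\<ge>0.
        \<phi> x = exp (lam * t) *
          (\<integral>\<omega>. exp (- integral {0..t} (\<lambda>s. V (subordinate_BM S B x s \<omega>))) *
                 \<phi> (subordinate_BM S B x t \<omega>) \<partial>completion M))"

end

theory Submission
  imports Defs
begin

text \<open>
  Put \<open>l = |\<lambda>|\<close>, \<open>t = 1/l\<close> and \<open>\<delta> = 1 / sqrt (inv \<Psi> (4 l))\<close>. If the maximum point \<open>x\<close> is not in the interior
  or is closer than \<open>\<delta>\<close> to the boundary, convexity gives a half-space \<open>H\<close> containing \<open>K\<close> whose
  complement is at distance less than \<open>\<delta>\<close> from \<open>x\<close>. In the normal direction \<open>X\<close> is a one-dimensional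
  subordinate Brownian motion; since \<open>\<Psi>(1/\<delta>\<^sup>2) = 4 l\<close>, Markov's inequality shows that \<open>S\<^sub>s \<ge> \<delta>\<^sup>2\<close> with
  probability at least \<open>1 - 1/e\<close> for \<open>s \<in> [t/2, t]\<close>, so \<open>X\<^sub>s\<close> lies outside \<open>H\<close> with a probability
  bounded below by a universal constant. Hence the time \<open>T\<close> that \<open>X\<close> spends outside \<open>H\<close> up to \<open>t\<close> has
  expectation at least a universal multiple of \<open>t\<close>, and \<open>E exp (- v T) \<le> 1 - \<epsilon>\<close> whenever \<open>v \<ge> l\<close>.
  Evaluating the Feynman-Kac formula at \<open>x\<close> yields \<open>1 \<le> exp ((v - l) t) (1 - \<epsilon>)\<close>, which fails when
  \<open>(v - l) / l\<close> is small.
\<close>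

section \<open>Half-spaces containing a convex set\<close>

lemma dist_Rd_nonneg [simp]: "0 \<le> dist_Rd d x y"
  by (simp add: dist_Rd_def)

lemma dist_Rd_same [simp]: "dist_Rd d x x = 0"
  by (simp add: dist_Rd_def L2_set_def)

lemma dist_Rd_commute: "dist_Rd d x y = dist_Rd d y x"
  by (simp add: dist_Rd_def L2_set_def power2_commute)

lemma dist_Rd_triangle: "dist_Rd d x z \<le> dist_Rd d x y + dist_Rd d y z"
  using L2_set_triangle_ineq[of "\<lambda>i. x i - y i" "\<lambda>i. y i - z i" "{..<d}"]
  by (simp add: dist_Rd_def)

lemma dist_Rd_power2: "(dist_Rd d x y)\<^sup>2 = (\<Sum>i<d. (x i - y i)\<^sup>2)"
  by (simp add: dist_Rd_def L2_set_def sum_nonneg)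

lemma Rd_eq: "Rd d = {x. \<forall>i\<ge>d. x i = 0}"
  by (rule topspace_Euclidean_space)

lemma openin_ball_Rd: "openin (Euclidean_space d) (ball_Rd d c r)"
proof -
  have "continuous_on UNIV (\<lambda>y :: nat \<Rightarrow> real. dist_Rd d c y)"
    unfolding dist_Rd_def L2_set_def
    by (intro continuous_intros continuous_on_product_coordinates)
  then have "open {y. dist_Rd d c y < r}"
    by (intro open_Collect_less continuous_intros)
  moreover have "ball_Rd d c r = {y. dist_Rd d c y < r} \<inter> Rd d"
    by (auto simp: ball_Rd_def)
  ultimately show ?thesis
    unfolding Euclidean_space_def
    by (metis Euclidean_space_def euclidean_product_topology open_openin openin_subtopology
        topspace_Euclidean_space)
qed

text \<open>The space carries the trace of the product topology. A basic product neighbourhood of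
  \<open>z\<close> contains a ball: coordinates from \<open>d\<close> on vanish for all points of
  \<open>Rd d\<close>, and the others are finitely many.\<close>

lemma interior_of_Euclidean_space_iff:
  assumes "z \<in> Rd d"
  shows "z \<in> Euclidean_space d interior_of K \<longleftrightarrow> (\<exists>e>0. ball_Rd d z e \<subseteq> K)"
proof
  assume "\<exists>e>0. ball_Rd d z e \<subseteq> K"
  then obtain e where "e > 0" "ball_Rd d z e \<subseteq> K" by blast
  moreover have "z \<in> ball_Rd d z e"
    using assms \<open>e > 0\<close> by (simp add: ball_Rd_def)
  ultimately show "z \<in> Euclidean_space d interior_of K"
    unfolding interior_of_def using openin_ball_Rd by blast
next
  assume "z \<in> Euclidean_space d interior_of K"
  then obtain U where U: "openin (Euclidean_space d) U" "z \<in> U" "U \<subseteq> K"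
    by (auto simp: interior_of_def)
  then obtain T where T: "openin (powertop_real UNIV) T" "U = T \<inter> Rd d"
    by (auto simp: Euclidean_space_def openin_subtopology)
  then have "z \<in> T" using U(2) by blast
  from T(1)[unfolded openin_product_topology_alt, rule_format, OF this]
  obtain W where "finite {i \<in> UNIV. W i \<noteq> topspace euclideanreal}
      \<and> (\<forall>i\<in>UNIV. openin euclideanreal (W i)) \<and> z \<in> Pi\<^sub>E UNIV W \<and> Pi\<^sub>E UNIV W \<subseteq> T"
    by (rule exE)
  then have W: "\<And>i. open (W i)" "z \<in> Pi\<^sub>E UNIV W" "Pi\<^sub>E UNIV W \<subseteq> T"
    by (simp_all only: open_openin UNIV_I ball_UNIV)
  have "\<forall>i. \<exists>e>0. \<forall>y. dist y (z i) < e \<longrightarrow> y \<in> W i"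
  proof
    fix i
    have "z i \<in> W i" using W(2) by (rule PiE_mem) simp
    then show "\<exists>e>0. \<forall>y. dist y (z i) < e \<longrightarrow> y \<in> W i"
      using W(1)[of i] unfolding open_dist by blast
  qed
  then obtain e where e: "\<And>i. e i > 0" "\<And>i y. dist y (z i) < e i \<Longrightarrow> y \<in> W i"
    by metis
  \<comment> \<open>The inserted \<open>1\<close> keeps the set nonempty for
    \<open>d = 0\<close>.\<close>
  define \<epsilon> where "\<epsilon> = Min (insert 1 (e ` {..<d}))"
  have "\<epsilon> > 0" using e(1) by (simp add: \<epsilon>_def)
  have "ball_Rd d z \<epsilon> \<subseteq> K"
  proof
    fix y assume y: "y \<in> ball_Rd d z \<epsilon>"
    have "y i \<in> W i" for i
    proof (cases "i < d")
      case True
      then have "\<bar>y i - z i\<bar> \<le> dist_Rd d z y"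
        using member_le_L2_set[of "{..<d}" i "\<lambda>i. \<bar>y i - z i\<bar>"]
        unfolding dist_Rd_commute[of d z y] by (simp add: dist_Rd_def L2_set_def)
      also have "\<dots> < \<epsilon>" using y by (simp add: ball_Rd_def)
      also have "\<epsilon> \<le> e i" using True by (simp add: \<epsilon>_def)
      finally show ?thesis by (intro e(2)) (simp add: dist_real_def)
    next
      case False
      then have "y i = z i" using assms y by (auto simp: Rd_eq ball_Rd_def)
      then show ?thesis using W(2) by auto
    qed
    then have "y \<in> T" using W(3) by auto
    then show "y \<in> K" using y T U by (auto simp: ball_Rd_def)
  qed
  then show "\<exists>e>0. ball_Rd d z e \<subseteq> K" using \<open>\<epsilon> > 0\<close> by blast
qed

section \<open>Frontier points and separation for bounded convex sets\<close>

lemma bounded_Rd_dist_le: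
  assumes "bounded_Rd d K"
  obtains R where "\<And>y. y \<in> K \<Longrightarrow> dist_Rd d p y \<le> R"
proof -
  obtain c R where "\<And>y. y \<in> K \<Longrightarrow> dist_Rd d c y \<le> R"
    using assms unfolding bounded_Rd_def by blast
  then have "dist_Rd d p y \<le> dist_Rd d p c + R" if "y \<in> K" for y
    using that dist_Rd_triangle[of d p y c] by fastforce
  then show ?thesis using that by blast
qed

text \<open>In a connected space only the empty set and the whole space have empty frontier. The
  infimum in \<open>dist_boundary\<close> is thus taken over a nonempty set.\<close>

lemma frontier_of_nonempty_Rd:
  assumes "d \<ge> 1" "K \<subseteq> Rd d" "bounded_Rd d K" "K \<noteq> {}"
  shows "Euclidean_space d frontier_of K \<noteq> {}"
proof -
  obtain R where R: "\<And>y. y \<in> K \<Longrightarrow> dist_Rd d (\<lambda>_. 0) y \<le> R"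
    using bounded_Rd_dist_le[OF assms(3)] by blast
  define w :: "nat \<Rightarrow> real" where "w = (\<lambda>i. if i = 0 then \<bar>R\<bar> + 1 else 0)"
  have "w \<in> Rd d" using assms(1) by (auto simp: Rd_eq w_def)
  moreover have "w \<notin> K"
  proof
    assume "w \<in> K"
    have "w 0 \<le> L2_set w {..<d}"
      using assms(1) by (intro member_le_L2_set) auto
    also have "\<dots> = dist_Rd d (\<lambda>_. 0) w" by (simp add: dist_Rd_def L2_set_def)
    finally show False using R[OF \<open>w \<in> K\<close>] by (simp add: w_def)
  qed
  ultimately show ?thesis
    using assms connected_space_frontier_eq_empty[of "Euclidean_space d" K]
      connected_Euclidean_space by blast
qed

text \<open>No nearest point is needed: a point whose squared distance from \<open>p\<close> is minimal up to a
  second-order error \<open>u\<^sup>2\<close> already yields a separating direction.\<close>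

lemma separating_direction_Rd:
  assumes K: "convex_seq K" "bounded_Rd d K" "K \<noteq> {}"
    and D: "D > 0" "\<And>y. y \<in> K \<Longrightarrow> D \<le> dist_Rd d p y"
  obtains n :: "nat \<Rightarrow> real" where "(\<Sum>i<d. (n i)\<^sup>2) = 1"
    "\<And>y. y \<in> K \<Longrightarrow> (\<Sum>i<d. n i * y i) \<le> (\<Sum>i<d. n i * p i)"
proof -
  obtain R where R: "\<And>y. y \<in> K \<Longrightarrow> dist_Rd d p y \<le> R"
    using bounded_Rd_dist_le[OF K(2)] by blast
  \<comment> \<open>\<open>Q\<close> bounds the squared diameter of \<open>K\<close>, and
    \<open>u\<close> is so small that the error \<open>u * (1 + Q)\<close> of the comparison below
    stays within \<open>2 * D\<^sup>2\<close>.\<close>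
  define Q where "Q = (2 * R)\<^sup>2"
  define u where "u = min 1 (2 * D\<^sup>2 / (1 + Q))"
  have Q: "Q \<ge> 0" by (simp add: Q_def)
  have u: "0 < u" "u \<le> 1" "u * (1 + Q) \<le> 2 * D\<^sup>2"
  proof -
    show "0 < u" "u \<le> 1" using D(1) Q by (auto simp: u_def intro!: divide_pos_pos)
    have "u * (1 + Q) \<le> 2 * D\<^sup>2 / (1 + Q) * (1 + Q)"
      using Q by (intro mult_right_mono) (auto simp: u_def)
    then show "u * (1 + Q) \<le> 2 * D\<^sup>2" using Q by simp
  qed
  define J where "J = (INF y\<in>K. (dist_Rd d p y)\<^sup>2)"
  have bdd: "bdd_below ((\<lambda>y. (dist_Rd d p y)\<^sup>2) ` K)" by (intro bdd_belowI2[of _ 0]) simp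
  have J: "J \<le> (dist_Rd d p y)\<^sup>2" if "y \<in> K" for y
    unfolding J_def by (rule cINF_lower[OF bdd that])
  have "J < J + u\<^sup>2" using u by simp
  then obtain y0 where y0: "y0 \<in> K" "(dist_Rd d p y0)\<^sup>2 < J + u\<^sup>2"
    unfolding J_def using cINF_less_iff[OF K(3) bdd] by blast
  define a where "a = (\<lambda>i. p i - y0 i)"
  have A: "(\<Sum>i<d. (a i)\<^sup>2) = (dist_Rd d p y0)\<^sup>2" by (simp add: a_def dist_Rd_power2)
  have Apos: "dist_Rd d p y0 > 0" "D\<^sup>2 \<le> (dist_Rd d p y0)\<^sup>2"
    using D y0(1) by (force, simp add: power_mono)
  have *: "(\<Sum>i<d. a i * y i) \<le> (\<Sum>i<d. a i * p i)" if "y \<in> K" for y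
  proof -
    define b where "b = (\<lambda>i. y i - y0 i)"
    \<comment> \<open>Moving from the near-minimiser \<open>y0\<close> a fraction \<open>u\<close>
      towards \<open>y\<close> cannot lower the squared distance by more than
      \<open>u\<^sup>2\<close>; expanding the square bounds the inner product of \<open>a\<close>
      and \<open>b\<close>.\<close>
    define w where "w = (\<lambda>i. (1 - u) * y0 i + u * y i)"
    have "w \<in> K" using K(1) y0(1) that u unfolding convex_seq_def w_def by simp
    have "(dist_Rd d p w)\<^sup>2 = (\<Sum>i<d. (a i)\<^sup>2 - 2 * u * (a i * b i) + u\<^sup>2 * (b i)\<^sup>2)"
      unfolding dist_Rd_power2
      by (intro sum.cong refl)
         (simp add: w_def a_def b_def power2_eq_square algebra_simps)
    also have "\<dots> = (dist_Rd d p y0)\<^sup>2 - 2 * u * (\<Sum>i<d. a i * b i) + u\<^sup>2 * (\<Sum>i<d. (b i)\<^sup>2)"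
      by (simp add: sum.distrib sum_subtractf sum_distrib_left A)
    finally have 1: "(dist_Rd d p w)\<^sup>2 = \<dots>" .
    have "dist_Rd d y y0 \<le> 2 * R"
      using dist_Rd_triangle[of d y y0 p] R[OF that] R[OF y0(1)] dist_Rd_commute[of d y p]
      by simp
    then have "(\<Sum>i<d. (b i)\<^sup>2) \<le> Q"
      using power_mono[of "dist_Rd d y y0" "2 * R" 2] by (simp add: dist_Rd_power2 b_def Q_def)
    then have "u\<^sup>2 * (\<Sum>i<d. (b i)\<^sup>2) \<le> u\<^sup>2 * Q" by (simp add: mult_left_mono)
    with 1 J[OF \<open>w \<in> K\<close>] y0(2) have "2 * u * (\<Sum>i<d. a i * b i) \<le> u\<^sup>2 + u\<^sup>2 * Q" by linarith
    then have "u * (2 * (\<Sum>i<d. a i * b i)) \<le> u * (u * (1 + Q))"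
      by (simp add: power2_eq_square algebra_simps)
    then have "2 * (\<Sum>i<d. a i * b i) \<le> u * (1 + Q)" using u(1) by simp
    then have "(\<Sum>i<d. a i * b i) \<le> (\<Sum>i<d. (a i)\<^sup>2)" using u(3) Apos(2) A by linarith
    moreover have "(\<Sum>i<d. a i * b i) = (\<Sum>i<d. a i * y i) - (\<Sum>i<d. a i * y0 i)"
      by (simp add: b_def right_diff_distrib sum_subtractf)
    moreover have "(\<Sum>i<d. (a i)\<^sup>2) = (\<Sum>i<d. a i * (p i - y0 i))"
      by (simp add: a_def power2_eq_square)
    moreover have "\<dots> = (\<Sum>i<d. a i * p i) - (\<Sum>i<d. a i * y0 i)"
      by (simp add: right_diff_distrib sum_subtractf)
    ultimately show ?thesis by linarith
  qed
  define n where "n = (\<lambda>i. a i / dist_Rd d p y0)"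
  show ?thesis
  proof (rule that[of n])
    show "(\<Sum>i<d. (n i)\<^sup>2) = 1"
      using Apos(1) by (simp add: n_def power_divide A flip: sum_divide_distrib)
    show "(\<Sum>i<d. n i * y i) \<le> (\<Sum>i<d. n i * p i)" if "y \<in> K" for y
      using divide_right_mono[OF *[OF that], of "dist_Rd d p y0"]
      by (simp add: n_def sum_divide_distrib)
  qed
qed

text \<open>If a point \<open>y\<close> of \<open>K\<close> were closer to \<open>z + \<eta> (z - c)\<close>, the convex combinations of \<open>y\<close> with
  the ball around \<open>c\<close> would fill a neighbourhood of \<open>z\<close>.\<close>

lemma convex_dist_ge_beyond_noninterior:
  assumes K: "convex_seq K" "K \<subseteq> Rd d"
    and ball: "c \<in> Rd d" "ball_Rd d c \<rho> \<subseteq> K"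
    and z: "z \<in> Rd d" "z \<notin> Euclidean_space d interior_of K"
    and \<eta>: "\<eta> > 0" and y: "y \<in> K"
  shows "\<eta> * \<rho> \<le> dist_Rd d (\<lambda>i. z i + \<eta> * (z i - c i)) y"
proof (rule ccontr)
  define p where "p = (\<lambda>i. z i + \<eta> * (z i - c i))"
  \<comment> \<open>Chosen so that
    \<open>(1 + \<eta>) * e + dist_Rd d p y = \<eta> * \<rho>\<close>, which puts \<open>c'\<close>
    below inside the ball around \<open>c\<close>.\<close>
  define e where "e = (\<eta> * \<rho> - dist_Rd d p y) / (1 + \<eta>)"
  assume "\<not> ?thesis"
  then have e: "e > 0" using \<eta> by (simp add: e_def p_def)
  have "ball_Rd d z e \<subseteq> K"
  proof
    fix w assume w: "w \<in> ball_Rd d z e"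
    \<comment> \<open>\<open>w\<close> is the convex combination of \<open>y\<close> and
      \<open>c'\<close> with weight \<open>\<eta> / (1 + \<eta>)\<close> on \<open>c'\<close>; for
      \<open>w = z\<close> and \<open>y = p\<close> this point would be \<open>c\<close>.\<close>
    define c' where "c' = (\<lambda>i. ((1 + \<eta>) * w i - y i) / \<eta>)"
    have "dist_Rd d c c' = L2_set (\<lambda>i. (1 / \<eta>) * ((1 + \<eta>) * (z i - w i) + (y i - p i))) {..<d}"
      unfolding dist_Rd_def
      by (intro L2_set_cong refl) (use \<eta> in \<open>simp add: c'_def p_def field_simps\<close>)
    also have "\<dots> \<le> (1 / \<eta>) * ((1 + \<eta>) * dist_Rd d z w + dist_Rd d p y)"
    proof -
      have "L2_set (\<lambda>i. (1 + \<eta>) * (z i - w i) + (y i - p i)) {..<d}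
          \<le> (1 + \<eta>) * dist_Rd d z w + dist_Rd d p y"
        using \<eta> L2_set_triangle_ineq[of "\<lambda>i. (1 + \<eta>) * (z i - w i)" "\<lambda>i. y i - p i" "{..<d}"]
        unfolding dist_Rd_commute[of d p y]
        by (simp add: dist_Rd_def flip: L2_set_right_distrib)
      then have "(1 / \<eta>) * L2_set (\<lambda>i. (1 + \<eta>) * (z i - w i) + (y i - p i)) {..<d}
          \<le> (1 / \<eta>) * ((1 + \<eta>) * dist_Rd d z w + dist_Rd d p y)"
        by (rule mult_left_mono) (use \<eta> in simp)
      moreover have "0 \<le> 1 / \<eta>" using \<eta> by simp
      ultimately show ?thesis by (simp only: L2_set_right_distrib)
    qed
    also have "\<dots> < (1 / \<eta>) * ((1 + \<eta>) * e + dist_Rd d p y)"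
      using w \<eta> by (intro mult_strict_left_mono add_strict_right_mono) (auto simp: ball_Rd_def)
    also have "\<dots> = \<rho>" using \<eta> by (simp add: e_def)
    finally have "dist_Rd d c c' < \<rho>" .
    moreover have "c' \<in> Rd d" using w y K(2) by (auto simp: c'_def Rd_eq ball_Rd_def)
    ultimately have "c' \<in> K" using ball(2) by (auto simp: ball_Rd_def)
    have "\<eta> / (1 + \<eta>) \<in> {0..1}" using \<eta> by simp
    from K(1)[unfolded convex_seq_def, rule_format, OF y \<open>c' \<in> K\<close> this]
    have "(\<lambda>i. (1 - \<eta> / (1 + \<eta>)) * y i + \<eta> / (1 + \<eta>) * c' i) \<in> K" .
    moreover have "(\<lambda>i. (1 - \<eta> / (1 + \<eta>)) * y i + \<eta> / (1 + \<eta>) * c' i) = w"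
    proof
      fix i
      have "1 - \<eta> / (1 + \<eta>) = 1 / (1 + \<eta>)" using \<eta> by (simp add: field_simps)
      then show "(1 - \<eta> / (1 + \<eta>)) * y i + \<eta> / (1 + \<eta>) * c' i = w i"
        using \<eta> by (simp add: c'_def flip: add_divide_distrib)
    qed
    ultimately show "w \<in> K" by simp
  qed
  then show False using z e interior_of_Euclidean_space_iff by blast
qed

text \<open>Pushing \<open>z\<close> slightly away from an interior point \<open>c\<close> gives a
  point \<open>p\<close> at positive distance from \<open>K\<close>, hence a separating direction.
  As \<open>p\<close> is still within \<open>\<delta>\<close> of \<open>x\<close>, the
  Cauchy-Schwarz inequality carries the level of \<open>p\<close> over to \<open>x\<close> with a
  loss less than \<open>\<delta>\<close>.\<close>

lemma halfspace_near_noninterior_point: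
  assumes K: "convex_seq K" "K \<subseteq> Rd d" "bounded_Rd d K" "Euclidean_space d interior_of K \<noteq> {}"
    and z: "z \<in> Rd d" "z \<notin> Euclidean_space d interior_of K"
    and x: "dist_Rd d x z < \<delta>"
  obtains n a where "(\<Sum>i<d. (n i)\<^sup>2) = 1" "\<And>y. y \<in> K \<Longrightarrow> (\<Sum>i<d. n i * y i) \<le> a"
    "a - \<delta> < (\<Sum>i<d. n i * x i)"
proof -
  obtain c where c: "c \<in> Euclidean_space d interior_of K" using K(4) by blast
  then have cR: "c \<in> Rd d"
    using interior_of_subset_topspace[of "Euclidean_space d" K] by blast
  then obtain \<rho> where \<rho>: "\<rho> > 0" "ball_Rd d c \<rho> \<subseteq> K"
    using c interior_of_Euclidean_space_iff by blast
  define g where "g = \<delta> - dist_Rd d x z"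
  \<comment> \<open>The displacement of \<open>p\<close> from \<open>z\<close> is then less than the
    slack \<open>g\<close>; the \<open>+ 1\<close> keeps the denominator positive.\<close>
  define \<eta> where "\<eta> = g / 2 / (dist_Rd d z c + 1)"
  have g: "g > 0" using x by (simp add: g_def)
  then have \<eta>: "\<eta> > 0" by (simp add: \<eta>_def add_nonneg_pos)
  have "K \<noteq> {}" using K(4) interior_of_subset by fastforce
  define p where "p = (\<lambda>i. z i + \<eta> * (z i - c i))"
  have "\<eta> * \<rho> \<le> dist_Rd d p y" if "y \<in> K" for y
    unfolding p_def using convex_dist_ge_beyond_noninterior[OF K(1,2) cR \<rho>(2) z \<eta> that] .
  then obtain n where n: "(\<Sum>i<d. (n i)\<^sup>2) = 1"
    "\<And>y. y \<in> K \<Longrightarrow> (\<Sum>i<d. n i * y i) \<le> (\<Sum>i<d. n i * p i)"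
    using separating_direction_Rd[OF K(1,3) \<open>K \<noteq> {}\<close>, of "\<eta> * \<rho>" p] \<eta> \<rho>(1) by auto
  have "dist_Rd d z p = L2_set (\<lambda>i. \<eta> * (c i - z i)) {..<d}"
    unfolding dist_Rd_def by (intro L2_set_cong) (auto simp: p_def algebra_simps)
  also have "\<dots> = \<eta> * dist_Rd d z c"
    using \<eta> unfolding dist_Rd_commute[of d z c]
    by (simp only: dist_Rd_def L2_set_right_distrib[OF less_imp_le])
  also have "\<dots> < g"
  proof -
    have "\<eta> * (dist_Rd d z c + 1) = g / 2"
      unfolding \<eta>_def
      by (rule nonzero_eq_divide_eq[THEN iffD1, OF _ refl])
         (use dist_Rd_nonneg[of d z c] in linarith)
    then show ?thesis using g \<eta> by (simp add: distrib_left)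
  qed
  finally have xp: "dist_Rd d x p < \<delta>" using dist_Rd_triangle[of d x p z] by (simp add: g_def)
  have "(\<Sum>i<d. n i * p i) - (\<Sum>i<d. n i * x i) = (\<Sum>i<d. n i * (p i - x i))"
    by (simp add: algebra_simps sum_subtractf)
  also have "\<dots> \<le> (\<Sum>i<d. \<bar>n i\<bar> * \<bar>p i - x i\<bar>)"
    by (intro sum_mono) (metis abs_ge_self abs_mult)
  also have "\<dots> \<le> L2_set n {..<d} * dist_Rd d p x"
    unfolding dist_Rd_def by (rule L2_set_mult_ineq)
  also have "\<dots> < \<delta>" using xp n(1) by (simp add: L2_set_def dist_Rd_commute)
  finally show ?thesis using that[of n "\<Sum>i<d. n i * p i"] n by simp
qed

lemma halfspace_near_boundary:
  assumes K: "convex_seq K" "K \<subseteq> Rd d" "bounded_Rd d K" "Euclidean_space d interior_of K \<noteq> {}"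
    and d: "d \<ge> 1" and x: "x \<in> Rd d" and \<delta>: "\<delta> > 0"
    and near: "\<not> (x \<in> Euclidean_space d interior_of K \<and> \<delta> \<le> dist_boundary d x K)"
  obtains n a where "(\<Sum>i<d. (n i)\<^sup>2) = 1" "\<And>y. y \<in> K \<Longrightarrow> (\<Sum>i<d. n i * y i) \<le> a"
    "a - \<delta> < (\<Sum>i<d. n i * x i)"
proof -
  have "\<exists>z\<in>Rd d. z \<notin> Euclidean_space d interior_of K \<and> dist_Rd d x z < \<delta>"
  proof (cases "x \<in> Euclidean_space d interior_of K")
    case False
    then show ?thesis using x \<delta> by (intro bexI[of _ x]) auto
  next
    case True
    have "K \<noteq> {}" using K(4) interior_of_subset by fastforce
    then have "Euclidean_space d frontier_of K \<noteq> {}"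
      using frontier_of_nonempty_Rd d K by blast
    \<comment> \<open>If every frontier point were at distance at least \<open>\<delta>\<close>, so
      would be the infimum. Whether the infimum is attained does not matter.\<close>
    with True near have "\<not> (\<forall>z\<in>Euclidean_space d frontier_of K. \<delta> \<le> dist_Rd d x z)"
      unfolding dist_boundary_def by (metis cINF_greatest)
    then show ?thesis
      using frontier_of_subset_topspace[of "Euclidean_space d" K]
      by (fastforce simp: frontier_of_def)
  qed
  then show ?thesis using halfspace_near_noninterior_point[OF K] that by blast
qed

section \<open>Subordinate Brownian motion in a fixed direction\<close>

text \<open>Time is rounded up to a grid of mesh \<open>1 / (m + 1)\<close>. The rounded process is
  pieced together from countably many measurable functions, and right continuity identifies its
  limit. \<open>max 0 t\<close> extends the time set to the whole line.\<close>

lemma borel_measurable_pair_right_continuous: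
  fixes Z :: "real \<Rightarrow> 'w \<Rightarrow> real"
  assumes Z: "\<And>t. t \<ge> 0 \<Longrightarrow> Z t \<in> borel_measurable M"
    and cont: "\<And>\<omega> t. \<omega> \<in> space M \<Longrightarrow> t \<ge> 0 \<Longrightarrow> continuous (at_right t) (\<lambda>t. Z t \<omega>)"
  shows "(\<lambda>(t, \<omega>). Z (max 0 t) \<omega>) \<in> borel_measurable (borel \<Otimes>\<^sub>M M)"
proof -
  \<comment> \<open>\<open>k m t\<close> is the index of the grid interval containing the time, and
    \<open>q m (k m t)\<close> its right endpoint. It lies strictly above the time, as convergence
    along \<open>at_right\<close> demands.\<close>
  define k :: "nat \<Rightarrow> real \<Rightarrow> nat" where "k m t = nat \<lfloor>real (Suc m) * max 0 t\<rfloor>" for m t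
  define q where "q m j = real (Suc j) / real (Suc m)" for m j
  have q0: "q m j \<ge> 0" for m j by (simp add: q_def)
  have q: "max 0 t < q m (k m t)" "q m (k m t) \<le> max 0 t + inverse (real (Suc m))" for m t
  proof -
    have "0 \<le> real (Suc m) * max 0 t" by simp
    then have "real (k m t) = of_int \<lfloor>real (Suc m) * max 0 t\<rfloor>"
      unfolding k_def by (simp only: of_nat_nat zero_le_floor)
    then have "max 0 t * real (Suc m) < real (Suc (k m t))" "real (k m t) \<le> max 0 t * real (Suc m)"
      unfolding mult.commute[of "max 0 t"] of_nat_Suc by linarith+
    then show "max 0 t < q m (k m t)" "q m (k m t) \<le> max 0 t + inverse (real (Suc m))"
      unfolding q_def
      by (simp_all only: pos_less_divide_eq pos_divide_le_eq of_nat_0_less_iff zero_less_Suc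
          distrib_right) simp
  qed
  show ?thesis
  proof (rule borel_measurable_LIMSEQ_real)
    fix m
    have [measurable]: "k m \<in> borel \<rightarrow>\<^sub>M count_space UNIV" unfolding k_def by measurable
    have [measurable]: "Z (q m j) \<in> borel_measurable M" for j using Z q0 by blast
    show "(\<lambda>(t, \<omega>). Z (q m (k m t)) \<omega>) \<in> borel_measurable (borel \<Otimes>\<^sub>M M)"
      unfolding case_prod_beta
      by (rule measurable_compose_countable[where f = "\<lambda>j p. Z (q m j) (snd p)"
            and g = "\<lambda>p. k m (fst p)"]) measurable
  next
    fix p assume "p \<in> space (borel \<Otimes>\<^sub>M M :: (real \<times> 'w) measure)"
    then obtain t \<omega> where p: "p = (t, \<omega>)" "\<omega> \<in> space M" by (auto simp: space_pair_measure)
    define \<tau> where "\<tau> = max 0 t"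
    have \<tau>: "\<tau> \<ge> 0" "\<And>m. \<tau> < q m (k m t)" "\<And>m. q m (k m t) \<le> \<tau> + inverse (real (Suc m))"
      using q unfolding \<tau>_def by (simp_all only: max.cobounded1)
    have "(\<lambda>m. \<tau> + inverse (real (Suc m))) \<longlonglongrightarrow> \<tau> + 0"
      by (intro tendsto_intros LIMSEQ_inverse_real_of_nat)
    then have lim: "(\<lambda>m. \<tau> + inverse (real (Suc m))) \<longlonglongrightarrow> \<tau>" by (simp only: add_0_right)
    have "(\<lambda>m. q m (k m t)) \<longlonglongrightarrow> \<tau>"
      by (rule real_tendsto_sandwich[OF _ _ tendsto_const lim])
         (intro always_eventually allI less_imp_le \<tau>; fact)+
    then have "filterlim (\<lambda>m. q m (k m t)) (at_right \<tau>) sequentially"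
      unfolding filterlim_at
      by (intro conjI always_eventually allI)
         (simp_all only: greaterThan_iff \<tau>(2) less_imp_neq[OF \<tau>(2), symmetric] simp_thms not_False_eq_True)
    moreover have "((\<lambda>t. Z t \<omega>) \<longlongrightarrow> Z \<tau> \<omega>) (at_right \<tau>)"
      using cont[OF p(2) \<tau>(1)] unfolding continuous_within .
    ultimately have "(\<lambda>m. Z (q m (k m t)) \<omega>) \<longlonglongrightarrow> Z \<tau> \<omega>"
      by (rule filterlim_compose[rotated])
    then show "(\<lambda>m. (\<lambda>(t, \<omega>). Z (q m (k m t)) \<omega>) p) \<longlonglongrightarrow> (case p of (t, \<omega>) \<Rightarrow> Z (max 0 t) \<omega>)"
      by (simp only: p prod.case \<tau>_def)
  qed
qed

section \<open>Brownian motion in a unit direction\<close>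

definition gauss_tail :: real where
  "gauss_tail = measure (density lborel (\<lambda>x. ennreal (normal_density 0 1 x))) {1..}"

lemma gauss_tail_pos: "gauss_tail > 0"
proof -
  let ?N = "density lborel (\<lambda>x. ennreal (normal_density 0 1 x))"
  interpret N: prob_space ?N by (rule prob_space_normal_density) simp
  have "emeasure ?N {1..} \<noteq> 0"
  proof
    assume "emeasure ?N {1..} = 0"
    then have "{1..} \<in> null_sets ?N" by (simp add: null_sets_def)
    then have "AE x in lborel. x \<in> {1::real..} \<longrightarrow> ennreal (normal_density 0 1 x) = 0"
      by (subst (asm) null_sets_density_iff) auto
    then have "AE x in lborel. x \<notin> {1::real..}"
      by eventually_elim (use normal_density_pos[of 1 0] in \<open>auto simp: ennreal_eq_0_iff simp flip: not_less\<close>)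
    then have "emeasure lborel {1::real..} = 0"
      by (subst (asm) AE_iff_null_sets[symmetric]) (auto simp: null_sets_def)
    moreover have "emeasure lborel {1..2::real} \<le> emeasure lborel {1::real..}"
      by (intro emeasure_mono) auto
    ultimately show False by simp
  qed
  then show ?thesis
    unfolding gauss_tail_def using N.emeasure_eq_measure measure_nonneg[of ?N "{1..}"]
    by (metis ennreal_0 less_eq_real_def)
qed

lemma gauss_tail_le_1: "gauss_tail \<le> 1"
  unfolding gauss_tail_def
  by (rule prob_space.prob_le_1[OF prob_space_normal_density]) simp

text \<open>The weighted coordinates are independent centred normals with variances
  \<open>2 * u * (n i)\<^sup>2\<close>, which add up to \<open>2 * u\<close> because
  \<open>n\<close> is a unit vector.\<close>

lemma brownian_directional_normal:
  assumes B: "brownian M d B" and n: "(\<Sum>i<d. (n i)\<^sup>2) = 1" and u: "u > 0"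
  shows "distributed M lborel (\<lambda>\<omega>. \<Sum>i<d. n i * B u \<omega> i)
           (\<lambda>x. ennreal (normal_density 0 (sqrt (2 * u)) x))"
proof -
  interpret prob_space M using B by (simp add: brownian_def)
  have b1: "brownian1 M (\<lambda>t \<omega>. B t \<omega> i)" if "i < d" for i
    using B that by (simp add: brownian_def)
  \<comment> \<open>Coordinates with \<open>n i = 0\<close> would contribute a degenerate normal
    variable without density, so they are dropped from the sum.\<close>
  define I where "I = {i. i < d \<and> n i \<noteq> 0}"
  have I: "finite I" "I \<subseteq> {..<d}" by (auto simp: I_def)
  have sumI: "(\<Sum>i<d. n i * f i) = (\<Sum>i\<in>I. n i * f i)" for f :: "nat \<Rightarrow> real"
    by (rule sum.mono_neutral_right) (auto simp: I_def)
  have n1: "(\<Sum>i\<in>I. (n i)\<^sup>2) = 1"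
    using sumI[of n] n by (simp add: power2_eq_square)
  then have "I \<noteq> {}" by force
  have "indep_vars (\<lambda>_. \<Pi>\<^sub>M t\<in>{0..}. borel) (\<lambda>i \<omega>. \<lambda>t\<in>{0..}. B t \<omega> i) I"
    using B I indep_vars_subset unfolding brownian_def by blast
  then have "indep_vars (\<lambda>_. borel) (\<lambda>i \<omega>. n i * (\<lambda>t\<in>{0..}. B t \<omega> i) u) I"
    by (rule indep_vars_compose2[where Y = "\<lambda>i f. n i * f u"])
       (use u in \<open>auto intro!: measurable_component_singleton borel_measurable_times\<close>)
  then have ind: "indep_vars (\<lambda>_. borel) (\<lambda>i \<omega>. n i * B u \<omega> i) I" using u by simp
  have nd: "distributed M lborel (\<lambda>\<omega>. n i * B u \<omega> i)
      (\<lambda>x. ennreal (normal_density 0 (\<bar>n i\<bar> * sqrt (2 * u)) x))" if "i \<in> I" for i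
  proof -
    have i: "i < d" "n i \<noteq> 0" using that by (auto simp: I_def)
    have "\<forall>t>0. distributed M lborel (\<lambda>\<omega>. B t \<omega> i - B 0 \<omega> i)
        (\<lambda>x. ennreal (normal_density 0 (sqrt (2 * (t - 0))) x))"
      using b1[OF i(1)] unfolding brownian1_def by blast
    then have "distributed M lborel (\<lambda>\<omega>. B u \<omega> i - B 0 \<omega> i)
        (\<lambda>x. ennreal (normal_density 0 (sqrt (2 * u)) x))" using u by simp
    from normal_density_affine[OF this _ i(2), of 0] u
    have "distributed M lborel (\<lambda>\<omega>. n i * (B u \<omega> i - B 0 \<omega> i))
        (\<lambda>x. ennreal (normal_density 0 (\<bar>n i\<bar> * sqrt (2 * u)) x))" by simp
    moreover have "B 0 \<omega> i = 0" if "\<omega> \<in> space M" for \<omega>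
      using b1[OF i(1)] that by (simp add: brownian1_def)
    moreover have "distr M lborel (\<lambda>\<omega>. n i * (B u \<omega> i - B 0 \<omega> i)) = distr M lborel (\<lambda>\<omega>. n i * B u \<omega> i)"
      using calculation(2) by (intro distr_cong) auto
    moreover have "(\<lambda>\<omega>. n i * (B u \<omega> i - B 0 \<omega> i)) \<in> M \<rightarrow>\<^sub>M lborel \<longleftrightarrow> (\<lambda>\<omega>. n i * B u \<omega> i) \<in> M \<rightarrow>\<^sub>M lborel"
      using calculation(2) by (intro measurable_cong) auto
    ultimately show ?thesis unfolding distributed_def by simp
  qed
  have "distributed M lborel (\<lambda>\<omega>. \<Sum>i\<in>I. n i * B u \<omega> i)
      (\<lambda>x. ennreal (normal_density (\<Sum>i\<in>I. 0) (sqrt (\<Sum>i\<in>I. (\<bar>n i\<bar> * sqrt (2 * u))\<^sup>2)) x))"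
    by (rule sum_indep_normal[OF I(1) \<open>I \<noteq> {}\<close> ind _ nd]) (use u in \<open>auto simp: I_def\<close>)
  moreover have "(\<Sum>i\<in>I. (\<bar>n i\<bar> * sqrt (2 * u))\<^sup>2) = 2 * u"
    using u n1 by (simp add: power_mult_distrib flip: sum_distrib_right)
  ultimately show ?thesis by (simp add: sumI)
qed

text \<open>Dividing by the standard deviation \<open>sqrt (2 * u)\<close> gives a standard normal
  variable. Since \<open>\<delta> \<le> sqrt (2 * u)\<close>, a value of at least 1 forces a
  displacement of at least \<open>\<delta>\<close>. The bound is free of the dimension.\<close>

lemma brownian_directional_tail:
  assumes B: "brownian M d B" and n: "(\<Sum>i<d. (n i)\<^sup>2) = 1" and \<delta>: "\<delta> > 0" "\<delta>\<^sup>2 \<le> u"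
  shows "gauss_tail \<le> measure M {\<omega> \<in> space M. \<delta> \<le> (\<Sum>i<d. n i * B u \<omega> i)}"
proof -
  interpret prob_space M using B by (simp add: brownian_def)
  let ?Y = "\<lambda>\<omega>. \<Sum>i<d. n i * B u \<omega> i"
  have u: "u > 0" using \<delta> by (smt (verit) zero_less_power)
  note Y = brownian_directional_normal[OF B n u]
  have [measurable]: "?Y \<in> borel_measurable M" using distributed_measurable[OF Y] by simp
  have "distributed M lborel (\<lambda>\<omega>. 1 / sqrt (2 * u) * ?Y \<omega>) (\<lambda>x. ennreal (normal_density 0 1 x))"
    using normal_density_affine[OF Y, of "1 / sqrt (2 * u)" 0] u by simp
  then have "gauss_tail = measure (distr M lborel (\<lambda>\<omega>. 1 / sqrt (2 * u) * ?Y \<omega>)) {1..}"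
    by (simp only: gauss_tail_def distributed_distr_eq_density)
  also have "\<dots> = measure M {\<omega> \<in> space M. 1 \<le> 1 / sqrt (2 * u) * ?Y \<omega>}"
    by (subst measure_distr) (auto intro!: arg_cong[where f = "measure M"])
  also have "\<dots> \<le> measure M {\<omega> \<in> space M. \<delta> \<le> ?Y \<omega>}"
  proof (rule finite_measure_mono)
    have "\<delta> = sqrt (\<delta>\<^sup>2)" using \<delta>(1) by simp
    also have "\<dots> \<le> sqrt (2 * u)" using \<delta> u by (subst real_sqrt_le_iff) linarith
    finally have "\<delta> \<le> sqrt (2 * u)" .
    then show "{\<omega> \<in> space M. 1 \<le> 1 / sqrt (2 * u) * ?Y \<omega>} \<subseteq> {\<omega> \<in> space M. \<delta> \<le> ?Y \<omega>}"
      using u by (auto simp: field_simps)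
  qed measurable
  finally show ?thesis .
qed

section \<open>Tails and measurability of the subordinated process\<close>

lemma subordinator_nonneg:
  assumes "subordinator M \<Psi> S" "\<omega> \<in> space M" "t \<ge> 0"
  shows "0 \<le> S t \<omega>"
proof -
  have "mono_on {0..} (\<lambda>t. S t \<omega>)" "S 0 \<omega> = 0"
    using assms by (auto simp: subordinator_def)
  then show ?thesis using assms(3) by (metis atLeast_iff mono_onD order_refl)
qed

text \<open>Markov's inequality for \<open>exp (- u * S s \<omega>)\<close>: when
  \<open>S s \<omega>\<close> is below \<open>1 / u\<close> this variable exceeds
  \<open>exp (- 1)\<close>, and its mean is the Laplace transform.\<close>

lemma subordinator_tail:
  assumes S: "subordinator M \<Psi> S" and s: "s \<ge> 0" and u: "u > 0"
  shows "1 - exp (1 - s * \<Psi> u) \<le> measure M {\<omega> \<in> space M. 1 / u \<le> S s \<omega>}"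
proof -
  interpret prob_space M using S by (simp add: subordinator_def)
  have [measurable]: "S s \<in> borel_measurable M" using S s by (simp add: subordinator_def)
  have L: "(\<integral>\<omega>. exp (- u * S s \<omega>) \<partial>M) = exp (- s * \<Psi> u)"
    using S s u by (simp add: subordinator_def)
  \<comment> \<open>A nonintegrable function would have integral \<open>0\<close>, but the Laplace
    transform is positive.\<close>
  have int: "integrable M (\<lambda>\<omega>. exp (- u * S s \<omega>))"
    using L not_integrable_integral_eq by fastforce
  have "1 - measure M {\<omega> \<in> space M. 1 / u \<le> S s \<omega>}
      = measure M (space M - {\<omega> \<in> space M. 1 / u \<le> S s \<omega>})"
    by (rule prob_compl[symmetric]) measurable
  also have "\<dots> \<le> measure M {\<omega> \<in> space M. exp (- 1) \<le> exp (- u * S s \<omega>)}"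
    using u by (intro finite_measure_mono) (auto simp: field_simps)
  also have "\<dots> \<le> (\<integral>\<omega>. exp (- u * S s \<omega>) \<partial>M) / exp (- 1)"
    by (rule integral_Markov_inequality_measure[OF int]) auto
  also have "\<dots> = exp (1 - s * \<Psi> u)" unfolding L by (simp flip: exp_diff)
  finally show ?thesis by simp
qed

lemma continuous_on_imp_continuous_at_right:
  fixes f :: "real \<Rightarrow> real"
  assumes "continuous_on {0..} f" "t \<ge> 0"
  shows "continuous (at_right t) f"
proof -
  have "continuous (at t within {0..}) f"
    using assms by (simp add: continuous_on_eq_continuous_within)
  then show ?thesis by (rule continuous_within_subset) (use assms(2) in auto)
qed

text \<open>The sigma-algebra of \<open>N\<close> is left open: the lemma is used both for
  \<open>M\<close> and for the sigma-algebra generated by the Brownian paths.\<close>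

lemma brownian_directional_measurable:
  assumes B: "brownian M d B" and space: "space N = space M"
    and N: "\<And>i t. i < d \<Longrightarrow> t \<ge> 0 \<Longrightarrow> (\<lambda>\<omega>. B t \<omega> i) \<in> borel_measurable N"
  shows "(\<lambda>(t, \<omega>). \<Sum>i<d. n i * B (max 0 t) \<omega> i) \<in> borel_measurable (borel \<Otimes>\<^sub>M N)"
proof (rule borel_measurable_pair_right_continuous)
  show "(\<lambda>\<omega>. \<Sum>i<d. n i * B t \<omega> i) \<in> borel_measurable N" if "t \<ge> 0" for t
    using N that by (intro borel_measurable_sum borel_measurable_times) auto
  show "continuous (at_right t) (\<lambda>t. \<Sum>i<d. n i * B t \<omega> i)"
    if "\<omega> \<in> space N" "t \<ge> 0" for \<omega> t
  proof (rule continuous_on_imp_continuous_at_right[OF _ that(2)])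
    show "continuous_on {0..} (\<lambda>t. \<Sum>i<d. n i * B t \<omega> i)"
      using B that(1) space
      by (intro continuous_intros) (auto simp: brownian_def brownian1_def)
  qed
qed

lemma subordinator_pair_measurable:
  assumes "subordinator M \<Psi> S"
  shows "(\<lambda>(t, \<omega>). S (max 0 t) \<omega>) \<in> borel_measurable (borel \<Otimes>\<^sub>M M)"
  using assms by (intro borel_measurable_pair_right_continuous) (auto simp: subordinator_def)

lemma subordinate_directional_measurable:
  assumes "subordinate_BM_setup M d \<Psi> S B"
  shows "(\<lambda>(t, \<omega>). \<Sum>i<d. n i * B (S (max 0 t) \<omega>) \<omega> i) \<in> borel_measurable (borel \<Otimes>\<^sub>M M)"
proof -
  have S: "subordinator M \<Psi> S" and B: "brownian M d B"
    using assms by (auto simp: subordinate_BM_setup_def)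
  note [measurable] = subordinator_pair_measurable[OF S, unfolded case_prod_beta]
  have "(\<lambda>p. (S (max 0 (fst p)) (snd p), snd p)) \<in> borel \<Otimes>\<^sub>M M \<rightarrow>\<^sub>M borel \<Otimes>\<^sub>M M"
    by measurable
  moreover have "(\<lambda>(t, \<omega>). \<Sum>i<d. n i * B (max 0 t) \<omega> i) \<in> borel_measurable (borel \<Otimes>\<^sub>M M)"
    using B by (intro brownian_directional_measurable[OF B]) (auto simp: brownian_def brownian1_def)
  ultimately have "(\<lambda>p. \<Sum>i<d. n i * B (max 0 (S (max 0 (fst p)) (snd p))) (snd p) i)
      \<in> borel_measurable (borel \<Otimes>\<^sub>M M)"
    using measurable_compose by fastforce
  then show ?thesis
    by (rule measurable_cong[THEN iffD1, rotated])
       (auto simp: space_pair_measure subordinator_nonneg[OF S] max_absorb2)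
qed

text \<open>Given \<open>S s = u\<close> with \<open>u \<ge> \<delta>\<^sup>2\<close>, independence
  leaves a Brownian motion at the fixed time \<open>u\<close>, to which the directional tail bound
  applies. Fubini's theorem replaces the conditioning.\<close>

lemma subordinate_directional_tail:
  assumes XS: "subordinate_BM_setup M d \<Psi> S B" and n: "(\<Sum>i<d. (n i)\<^sup>2) = 1"
    and \<delta>: "\<delta> > 0" and s: "s \<ge> 0"
  shows "gauss_tail * measure M {\<omega> \<in> space M. \<delta>\<^sup>2 \<le> S s \<omega>}
    \<le> measure M {\<omega> \<in> space M. \<delta> \<le> (\<Sum>i<d. n i * B (S s \<omega>) \<omega> i)}"
proof -
  have S: "subordinator M \<Psi> S" and B: "brownian M d B" and ind: "indep_processes M d S B"
    using XS by (auto simp: subordinate_BM_setup_def)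
  interpret prob_space M using S by (simp add: subordinator_def)
  have [measurable]: "S s \<in> borel_measurable M" using S s by (simp add: subordinator_def)
  define pS where "pS = (\<lambda>\<omega>. \<lambda>t\<in>{0..}. S t \<omega>)"
  define pB where "pB = (\<lambda>\<omega>. \<lambda>p\<in>{..<d} \<times> {0..}. B (snd p) \<omega> (fst p))"
  define L where "L = vimage_algebra (space M) pS (\<Pi>\<^sub>M t\<in>{0..}. borel)"
  define N where "N = vimage_algebra (space M) pB (\<Pi>\<^sub>M p\<in>{..<d} \<times> {0..}. borel)"
  have LN: "indep_set (sets L) (sets N)"
    using ind by (simp add: indep_processes_def L_def N_def pS_def pB_def)
  have spN: "space N = space M" and spL: "space L = space M" by (simp_all add: N_def L_def)
  have "sets N \<subseteq> events" using LN by (rule indep_setD_ev2)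
  then have idm[measurable]: "(\<lambda>\<omega>. \<omega>) \<in> M \<rightarrow>\<^sub>M N"
    using sets.sets_into_space[of _ N] by (intro measurableI) (auto simp: spN Int_absorb2)
  have SL: "S s \<in> borel_measurable L"
  proof -
    have "pS \<in> L \<rightarrow>\<^sub>M (\<Pi>\<^sub>M t\<in>{0..}. borel)"
      unfolding L_def by (rule measurable_vimage_algebra1) (auto simp: pS_def space_PiM)
    from measurable_compose[OF this measurable_component_singleton[of s]] s
    show ?thesis by (simp add: pS_def)
  qed
  have BN: "(\<lambda>\<omega>. B t \<omega> i) \<in> borel_measurable N" if "i < d" "t \<ge> 0" for i t
  proof -
    have "pB \<in> N \<rightarrow>\<^sub>M (\<Pi>\<^sub>M p\<in>{..<d} \<times> {0..}. borel)"
      unfolding N_def by (rule measurable_vimage_algebra1) (auto simp: pB_def space_PiM)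
    from measurable_compose[OF this measurable_component_singleton[of "(i, t)"]] that
    show ?thesis by (simp add: pB_def)
  qed
  \<comment> \<open>By independence the joint law of the time \<open>S s\<close> and of the sample
    point, the latter seen only through \<open>N\<close>, is a product measure; it suffices to check
    this on rectangles.\<close>
  have joint: "distr M borel (S s) \<Otimes>\<^sub>M distr M N (\<lambda>\<omega>. \<omega>)
      = distr M (borel \<Otimes>\<^sub>M N) (\<lambda>\<omega>. (S s \<omega>, \<omega>))"
  proof (rule pair_measure_eqI)
    show "sigma_finite_measure (distr M borel (S s))" "sigma_finite_measure (distr M N (\<lambda>\<omega>. \<omega>))"
      by (intro prob_space_imp_sigma_finite prob_space_distr; measurable)+
    show "sets (distr M borel (S s) \<Otimes>\<^sub>M distr M N (\<lambda>\<omega>. \<omega>))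
        = sets (distr M (borel \<Otimes>\<^sub>M N) (\<lambda>\<omega>. (S s \<omega>, \<omega>)))"
      by (simp cong: sets_pair_measure_cong)
    fix A C assume "A \<in> sets (distr M borel (S s))" "C \<in> sets (distr M N (\<lambda>\<omega>. \<omega>))"
    then have [measurable]: "A \<in> sets borel" "C \<in> sets N" by auto
    have CM: "C \<subseteq> space M" using sets.sets_into_space[OF \<open>C \<in> sets N\<close>] spN by simp
    have "S s -` A \<inter> space M \<in> sets L"
      using measurable_sets[OF SL \<open>A \<in> sets borel\<close>] by (simp add: spL)
    from indep_setD[OF LN this \<open>C \<in> sets N\<close>]
    have "prob ((S s -` A \<inter> space M) \<inter> C) = prob (S s -` A \<inter> space M) * prob C" .
    moreover have "(\<lambda>\<omega>. (S s \<omega>, \<omega>)) -` (A \<times> C) \<inter> space M = (S s -` A \<inter> space M) \<inter> C"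
      using CM by auto
    moreover have "(\<lambda>\<omega>. \<omega>) -` C \<inter> space M = C" using CM by auto
    ultimately show "emeasure (distr M borel (S s)) A * emeasure (distr M N (\<lambda>\<omega>. \<omega>)) C
        = emeasure (distr M (borel \<Otimes>\<^sub>M N) (\<lambda>\<omega>. (S s \<omega>, \<omega>))) (A \<times> C)"
      by (simp add: emeasure_distr emeasure_eq_measure ennreal_mult)
  qed
  note f = brownian_directional_measurable[OF B spN BN, of n]
  define A where "A = {p \<in> space (borel \<Otimes>\<^sub>M N). \<delta> \<le> (\<Sum>i<d. n i * B (max 0 (fst p)) (snd p) i)}"
  have A[measurable]: "A \<in> sets (borel \<Otimes>\<^sub>M N)"
    unfolding A_def using f by (simp add: case_prod_beta)
  interpret D: prob_space "distr M N (\<lambda>\<omega>. \<omega>)" by (rule prob_space_distr) measurable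
  \<comment> \<open>For \<open>u\<close> below \<open>\<delta>\<^sup>2\<close> the left side is
    \<open>0\<close>; otherwise the section of \<open>A\<close> at \<open>u\<close> is the event of
    the directional tail bound at time \<open>u\<close>.\<close>
  have slice: "ennreal gauss_tail * indicator {\<delta>\<^sup>2..} u
      \<le> emeasure (distr M N (\<lambda>\<omega>. \<omega>)) (Pair u -` A)" for u
  proof (cases "\<delta>\<^sup>2 \<le> u")
    case True
    then have u: "u \<ge> 0" by (rule order_trans[rotated]) simp
    have "Pair u -` A = {\<omega> \<in> space M. \<delta> \<le> (\<Sum>i<d. n i * B u \<omega> i)}"
      using u by (auto simp: A_def space_pair_measure spN max_absorb2)
    moreover have "Pair u -` A \<in> sets N" using A by (rule sets_Pair1)
    ultimately have "emeasure (distr M N (\<lambda>\<omega>. \<omega>)) (Pair u -` A)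
        = ennreal (measure M {\<omega> \<in> space M. \<delta> \<le> (\<Sum>i<d. n i * B u \<omega> i)})"
      by (subst emeasure_distr)
         (auto simp: emeasure_eq_measure intro!: arg_cong[where f = "measure M"])
    then show ?thesis
      using brownian_directional_tail[OF B n \<delta> True] True by (simp add: ennreal_leI)
  qed simp
  have "ennreal (gauss_tail * measure M {\<omega> \<in> space M. \<delta>\<^sup>2 \<le> S s \<omega>})
      = ennreal gauss_tail * emeasure (distr M borel (S s)) {\<delta>\<^sup>2..}"
    using gauss_tail_pos
    by (subst emeasure_distr)
       (auto simp: ennreal_mult emeasure_eq_measure vimage_def
         intro!: arg_cong[where f = "\<lambda>X. _ * ennreal (measure M X)"])
  also have "\<dots> = (\<integral>\<^sup>+u. ennreal gauss_tail * indicator {\<delta>\<^sup>2..} u \<partial>distr M borel (S s))"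
    by (subst nn_integral_cmult_indicator) auto
  also have "\<dots> \<le> (\<integral>\<^sup>+u. emeasure (distr M N (\<lambda>\<omega>. \<omega>)) (Pair u -` A) \<partial>distr M borel (S s))"
    by (intro nn_integral_mono slice)
  also have "\<dots> = emeasure (distr M borel (S s) \<Otimes>\<^sub>M distr M N (\<lambda>\<omega>. \<omega>)) A"
    by (rule D.emeasure_pair_measure_alt[symmetric]) simp
  also have "\<dots> = emeasure M {\<omega> \<in> space M. \<delta> \<le> (\<Sum>i<d. n i * B (S s \<omega>) \<omega> i)}"
  proof -
    have "(\<lambda>\<omega>. (S s \<omega>, \<omega>)) -` A \<inter> space M
        = {\<omega> \<in> space M. \<delta> \<le> (\<Sum>i<d. n i * B (S s \<omega>) \<omega> i)}"
      using subordinator_nonneg[OF S _ s] by (auto simp: A_def space_pair_measure spN max_absorb2)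
    then show ?thesis unfolding joint by (simp add: emeasure_distr[OF _ A])
  qed
  finally show ?thesis by (simp add: emeasure_eq_measure)
qed

section \<open>Occupation time above a level\<close>

definition time_above :: "(real \<Rightarrow> real) \<Rightarrow> real \<Rightarrow> real \<Rightarrow> real" where
  "time_above y a t = (LINT s|lborel. indicator {0..t} s * indicator {a<..} (y s))"

text \<open>Links the Lebesgue integral in \<open>time_above\<close>, to which Fubini's theorem
  applies, with the gauge integral in the Feynman-Kac functional.\<close>

lemma time_above_has_integral:
  assumes [measurable]: "y \<in> borel_measurable borel"
  shows "((\<lambda>s. indicator {a<..} (y s)) has_integral time_above y a t) {0..t}"
proof -
  have "set_integrable lborel {0..t} (\<lambda>s. indicator {a<..} (y s) :: real)"
    unfolding set_integrable_def
    by (rule Bochner_Integration.integrable_bound[of _ "indicator {0..t} :: real \<Rightarrow> real"])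
       (auto simp: indicator_def[of "{a<..}"] intro!: integrable_real_indicator
         simp: emeasure_lborel_Icc_eq)
  from set_borel_integral_eq_integral[OF this] show ?thesis
    by (simp add: has_integral_iff time_above_def set_lebesgue_integral_def)
qed

lemma time_above_bounds:
  assumes "y \<in> borel_measurable borel" "t \<ge> 0"
  shows "0 \<le> time_above y a t" "time_above y a t \<le> t"
proof -
  note T = time_above_has_integral[OF assms(1)]
  show "0 \<le> time_above y a t" by (rule has_integral_nonneg[OF T]) simp
  have "((\<lambda>s. 1) has_integral t) {0..t}"
    using has_integral_const_real[of "1::real" 0 t] assms(2) by simp
  then show "time_above y a t \<le> t"
    by (rule has_integral_le[OF T]) (simp add: indicator_def)
qed

text \<open>By Fubini's theorem the expected occupation time is the time integral of the
  probabilities. The bound \<open>q\<close> covers the second half of the interval, and the first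
  half contributes a nonnegative amount.\<close>

lemma (in prob_space) time_above_expectation:
  fixes Y :: "real \<Rightarrow> 'a \<Rightarrow> real"
  assumes Y[measurable]: "(\<lambda>(s, \<omega>). Y s \<omega>) \<in> borel_measurable (borel \<Otimes>\<^sub>M M)"
    and t: "t \<ge> 0"
    and q: "\<And>s. s \<in> {t / 2..t} \<Longrightarrow> q \<le> prob {\<omega> \<in> space M. a < Y s \<omega>}"
  shows "integrable M (\<lambda>\<omega>. time_above (\<lambda>s. Y s \<omega>) a t)"
    and "q * (t / 2) \<le> expectation (\<lambda>\<omega>. time_above (\<lambda>s. Y s \<omega>) a t)"
proof -
  interpret P: pair_sigma_finite lborel M ..
  define f where "f = (\<lambda>(s, \<omega>). indicator {0..t} s * indicator {a<..} (Y s \<omega>) :: real)"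
  have fm[measurable]: "f \<in> borel_measurable (lborel \<Otimes>\<^sub>M M)"
    unfolding f_def by measurable
  have E: "emeasure (lborel \<Otimes>\<^sub>M M) ({0..t} \<times> space M) = ennreal t"
    using t by (subst emeasure_pair_measure_Times) (auto simp: emeasure_space_1)
  have int: "integrable (lborel \<Otimes>\<^sub>M M) f"
  proof (rule Bochner_Integration.integrable_bound)
    show "integrable (lborel \<Otimes>\<^sub>M M) (indicator ({0..t} \<times> space M) :: _ \<Rightarrow> real)"
      by (rule integrable_real_indicator) (auto simp: E)
    show "AE p in lborel \<Otimes>\<^sub>M M. norm (f p) \<le> norm (indicator ({0..t} \<times> space M) p :: real)"
      by (rule AE_I2) (auto simp: f_def space_pair_measure indicator_def)
  qed measurable
  have Ta: "(\<lambda>\<omega>. time_above (\<lambda>s. Y s \<omega>) a t) = (\<lambda>\<omega>. LINT s|lborel. f (s, \<omega>))"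
    by (simp add: time_above_def f_def fun_eq_iff)
  show "integrable M (\<lambda>\<omega>. time_above (\<lambda>s. Y s \<omega>) a t)"
    unfolding Ta using P.integrable_snd[of "\<lambda>s \<omega>. f (s, \<omega>)"] int by simp
  have sl: "(LINT \<omega>|M. f (s, \<omega>)) = indicator {0..t} s * prob {\<omega> \<in> space M. a < Y s \<omega>}" for s
  proof -
    have "(LINT \<omega>|M. f (s, \<omega>)) = (LINT \<omega>|M. indicator {0..t} s * indicator {\<omega> \<in> space M. a < Y s \<omega>} \<omega>)"
      by (intro Bochner_Integration.integral_cong refl) (auto simp: f_def indicator_def)
    then show ?thesis by (simp add: Int_absorb2)
  qed
  have "q * (t / 2) = (LINT s|lborel. indicator {t / 2..t} s * q)"
    using t by (simp add: mult.commute)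
  also have "\<dots> \<le> (LINT s|lborel. LINT \<omega>|M. f (s, \<omega>))"
  proof (rule integral_mono)
    show "integrable lborel (\<lambda>s. LINT \<omega>|M. f (s, \<omega>))"
      using P.integrable_fst[of "\<lambda>s \<omega>. f (s, \<omega>)"] int by simp
    show "indicator {t / 2..t} s * q \<le> (LINT \<omega>|M. f (s, \<omega>))" for s
      unfolding sl using q t by (auto simp: indicator_def)
    show "integrable lborel (\<lambda>s. indicator {t / 2..t} s * q)"
      by (intro integrable_mult_left integrable_real_indicator) (auto simp: emeasure_lborel_Icc_eq)
  qed
  also have "\<dots> = expectation (\<lambda>\<omega>. time_above (\<lambda>s. Y s \<omega>) a t)"
    unfolding Ta using P.Fubini_integral[of "\<lambda>s \<omega>. f (s, \<omega>)"] int by simp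
  finally show "q * (t / 2) \<le> expectation (\<lambda>\<omega>. time_above (\<lambda>s. Y s \<omega>) a t)" .
qed

section \<open>Feynman-Kac estimate at the maximum\<close>

text \<open>Continuity, the limit \<open>0\<close> at the origin and unboundedness let the
  intermediate value theorem reach every \<open>y > 0\<close>. So \<open>inv_into\<close> returns a
  true preimage there.\<close>

lemma bernstein0_unbounded_surj:
  assumes "\<Psi> \<in> bernstein0" "\<not> bounded (\<Psi> ` {0<..})" "y > 0"
  shows "y \<in> \<Psi> ` {0<..}"
proof -
  have nonneg: "\<Psi> u \<ge> 0" if "u > 0" for u using assms(1) that by (simp add: bernstein0_def)
  have "\<forall>u>0. (deriv ^^ 0) \<Psi> differentiable at u" using assms(1) unfolding bernstein0_def by blast
  then have cont: "isCont \<Psi> u" if "u > 0" for u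
    using that by (simp add: differentiable_imp_continuous_within)
  have "\<exists>w>0. \<Psi> w > y"
  proof (rule ccontr)
    assume "\<not> (\<exists>w>0. \<Psi> w > y)"
    then have "norm (\<Psi> u) \<le> y" if "u > 0" for u
      using that nonneg[OF that] by (metis not_less real_norm_def abs_of_nonneg)
    then show False using assms(2) by (auto simp: bounded_iff)
  qed
  then obtain w where w: "w > 0" "\<Psi> w > y" by blast
  have "(\<Psi> \<longlongrightarrow> 0) (at_right 0)" using assms(1) by (simp add: bernstein0_def)
  then have "\<forall>\<^sub>F u in at_right 0. \<Psi> u < y" using assms(3) by (rule order_tendstoD)
  moreover have "\<forall>\<^sub>F u in at_right 0. u \<in> {0<..<w}" using w(1) by (rule eventually_at_right_real)
  ultimately have "\<forall>\<^sub>F u in at_right 0. \<Psi> u < y \<and> u \<in> {0<..<w}" by (rule eventually_conj)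
  then obtain u where u: "\<Psi> u < y" "0 < u" "u < w"
    using eventually_happens'[OF trivial_limit_at_right_real] by fastforce
  then obtain z where "u \<le> z" "\<Psi> z = y"
    using IVT[of \<Psi> u y w] w(2) cont by force
  then show ?thesis using u(2) by force
qed

text \<open>The convex function \<open>exp\<close> lies below its chord over
  \<open>{- 1..0}\<close>. A bound affine in \<open>\<theta>\<close> turns an estimate of the mean
  occupation time into one of the mean exponential.\<close>

lemma exp_neg_le_chord:
  fixes \<theta> :: real
  assumes "0 \<le> \<theta>" "\<theta> \<le> 1"
  shows "exp (- \<theta>) \<le> 1 - (1 - exp (- 1)) * \<theta>"
  using convex_onD[OF exp_convex, of \<theta> 0 "- 1 :: real"] assms by (simp add: algebra_simps)

text \<open>While \<open>y s > a\<close> the path is outside the half-space, hence outside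
  \<open>K\<close>, and the potential vanishes; only the remaining time can add to the exponent, at
  rate at most \<open>v\<close>.\<close>

lemma feynman_kac_weight_le:
  assumes n: "\<And>y. y \<in> K \<Longrightarrow> (\<Sum>i<d. n i * y i) \<le> a" and v: "v \<ge> 0" and t: "t \<ge> 0"
    and y: "\<And>s. s \<in> {0..t} \<Longrightarrow> y s = (\<Sum>i<d. n i * X s i)"
    and ym: "y \<in> borel_measurable borel"
  shows "- integral {0..t} (\<lambda>s. - v * indicator K (X s)) \<le> v * (t - time_above y a t)"
proof (cases "(\<lambda>s. - v * indicator K (X s)) integrable_on {0..t}")
  case True
  have "((\<lambda>s. 1) has_integral t) {0..t}"
    using has_integral_const_real[of "1::real" 0 t] t by simp
  from has_integral_mult_right[OF has_integral_diff[OF this time_above_has_integral[OF ym]], of v a]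
  have "((\<lambda>s. v * (1 - indicator {a<..} (y s))) has_integral v * (t - time_above y a t)) {0..t}" .
  then show ?thesis
    unfolding integral_neg[symmetric]
  proof (rule has_integral_le[OF integrable_integral[OF integrable_neg[OF True]]])
    fix s assume s: "s \<in> {0..t}"
    show "- (- v * indicator K (X s)) \<le> v * (1 - indicator {a<..} (y s))"
    proof (cases "X s \<in> K")
      case True
      then have "\<not> a < y s" using n y[OF s] by (simp add: not_less)
      then show ?thesis using True by simp
    next
      case False
      then show ?thesis using v by (simp add: indicator_def)
    qed
  qed
next
  case False
  \<comment> \<open>the gauge integral is then \<open>0\<close>\<close>
  then show ?thesis
    using v time_above_bounds(2)[OF ym t, of a] unfolding not_integrable_integral[OF False]
    by simp
qed

text \<open>The modulus of \<open>\<phi>\<close> at the random endpoint is at most its positive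
  maximum at \<open>x\<close>, which then cancels. \<open>G\<close> is an
  \<open>M\<close>-integrable majorant because the weight itself may fail to be
  \<open>M\<close>-measurable.\<close>

lemma eigenfunction_maximum_bound:
  assumes prob: "prob_space M"
    and \<phi>: "eigenfunction M d S B V lam \<phi>"
    and x: "x \<in> Rd d" "\<And>y. y \<in> Rd d \<Longrightarrow> cmod (\<phi> y) \<le> cmod (\<phi> x)" and t: "t \<ge> 0"
    and X: "\<And>\<omega>. \<omega> \<in> space M \<Longrightarrow> subordinate_BM S B x t \<omega> \<in> Rd d"
    and G: "integrable M G" "\<And>\<omega>. \<omega> \<in> space M \<Longrightarrow>
      exp (- integral {0..t} (\<lambda>s. V (subordinate_BM S B x s \<omega>))) \<le> G \<omega>"
  shows "1 \<le> exp (lam * t) * integral\<^sup>L M G"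
proof -
  let ?X = "subordinate_BM S B x"
  let ?F = "\<lambda>\<omega>. exp (- integral {0..t} (\<lambda>s. V (?X s \<omega>))) * \<phi> (?X t \<omega>)"
  obtain z where "z \<in> Rd d" "\<phi> z \<noteq> 0" using \<phi> by (auto simp: eigenfunction_def)
  then have pos: "cmod (\<phi> x) > 0" using x(2)[of z] by (smt (verit) zero_less_norm_iff)
  have rep: "\<phi> x = exp (lam * t) * (\<integral>\<omega>. ?F \<omega> \<partial>completion M)"
    using \<phi> x(1) t unfolding eigenfunction_def by blast
  have Gm: "G \<in> borel_measurable M" using G(1) by simp
  \<comment> \<open>otherwise the integral would be \<open>0\<close> and \<open>\<phi> x\<close> would vanish\<close>
  have intF: "integrable (completion M) ?F"
    using rep pos not_integrable_integral_eq by fastforce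
  have "cmod (\<integral>\<omega>. ?F \<omega> \<partial>completion M) \<le> (\<integral>\<omega>. cmod (\<phi> x) * G \<omega> \<partial>completion M)"
  proof (rule order_trans[OF integral_norm_bound integral_mono])
    show "integrable (completion M) (\<lambda>\<omega>. cmod (?F \<omega>))" using intF by (rule integrable_norm)
    show "integrable (completion M) (\<lambda>\<omega>. cmod (\<phi> x) * G \<omega>)"
      using G(1) integrable_completion[OF Gm] by simp
    show "cmod (?F \<omega>) \<le> cmod (\<phi> x) * G \<omega>" if "\<omega> \<in> space (completion M)" for \<omega>
    proof -
      have "cmod (?F \<omega>) = exp (- integral {0..t} (\<lambda>s. V (?X s \<omega>))) * cmod (\<phi> (?X t \<omega>))"
        by (simp add: norm_mult)
      also have "\<dots> \<le> G \<omega> * cmod (\<phi> x)"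
        using that by (intro mult_mono' G(2) x(2) X) auto
      finally show ?thesis by (simp add: mult.commute)
    qed
  qed
  also have "\<dots> = cmod (\<phi> x) * integral\<^sup>L M G"
    by (simp add: integral_completion[OF Gm])
  finally have le: "cmod (\<integral>\<omega>. ?F \<omega> \<partial>completion M) \<le> cmod (\<phi> x) * integral\<^sup>L M G" .
  have "cmod (\<phi> x) = exp (lam * t) * cmod (\<integral>\<omega>. ?F \<omega> \<partial>completion M)"
    by (subst rep) (simp add: norm_mult)
  also have "\<dots> \<le> exp (lam * t) * (cmod (\<phi> x) * integral\<^sup>L M G)"
    using le by (rule mult_left_mono) simp
  finally have "cmod (\<phi> x) * 1 \<le> cmod (\<phi> x) * (exp (lam * t) * integral\<^sup>L M G)"
    by (simp add: mult_ac)
  then show ?thesis using pos by (simp only: mult_le_cancel_left_pos)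
qed

text \<open>The number \<open>\<epsilon>\<close> of the overview: \<open>gauss_tail\<close> and one
  factor \<open>1 - exp (- 1)\<close> bound the probability of being outside the half-space,
  \<open>1 / 2\<close> is the share of the time interval used, and the other factor is the slope of
  the chord of \<open>exp\<close>.\<close>

definition killing_gain :: real where
  "killing_gain = (1 - exp (- 1))\<^sup>2 * gauss_tail / 2"

lemma killing_gain_bounds: "0 < killing_gain" "killing_gain < 1"
proof -
  show "0 < killing_gain" unfolding killing_gain_def using gauss_tail_pos by simp
  have "(1 - exp (- 1) :: real)\<^sup>2 \<le> 1" by (intro power_le_one) auto
  then have "(1 - exp (- 1))\<^sup>2 * gauss_tail \<le> 1"
    using gauss_tail_pos gauss_tail_le_1 by (intro mult_le_one) auto
  then show "killing_gain < 1" by (simp add: killing_gain_def)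
qed

text \<open>With \<open>\<delta> = 1 / sqrt u\<close>, the choice \<open>\<Psi> u = 4 l\<close> makes the exponent \<open>1 - s \<Psi>(1/\<delta>\<^sup>2)\<close> of the tail
  bound for \<open>S\<^sub>s\<close> at most \<open>-1\<close> on the second half of the time interval \<open>[0, 1/l]\<close>.\<close>

lemma time_above_lower_bound:
  assumes XS: "subordinate_BM_setup M d \<Psi> S B" and n: "(\<Sum>i<d. (n i)\<^sup>2) = 1"
    and u: "u > 0" "\<Psi> u = 4 * l" and l: "l > 0"
    and a: "a - 1 / sqrt u < (\<Sum>i<d. n i * x i)"
    and Y: "Y = (\<lambda>s \<omega>. (\<Sum>i<d. n i * x i) + (\<Sum>i<d. n i * B (S (max 0 s) \<omega>) \<omega> i))"
  shows "integrable M (\<lambda>\<omega>. time_above (\<lambda>s. Y s \<omega>) a (1 / l))"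
    and "killing_gain \<le> (1 - exp (- 1)) * l * integral\<^sup>L M (\<lambda>\<omega>. time_above (\<lambda>s. Y s \<omega>) a (1 / l))"
proof -
  have S: "subordinator M \<Psi> S" using XS by (simp add: subordinate_BM_setup_def)
  interpret prob_space M using S by (simp add: subordinator_def)
  let ?q = "gauss_tail * (1 - exp (- 1))"
  note [measurable] = subordinate_directional_measurable[OF XS, of n, unfolded case_prod_beta]
  have Ym: "(\<lambda>(s, \<omega>). Y s \<omega>) \<in> borel_measurable (borel \<Otimes>\<^sub>M M)"
    unfolding Y case_prod_beta by measurable
  have q: "?q \<le> prob {\<omega> \<in> space M. a < Y s \<omega>}" if s: "s \<in> {1 / l / 2..1 / l}" for s
  proof -
    have "1 / l / 2 > 0" using l by simp
    then have s0: "s \<ge> 0" using s by simp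
    have "1 / l / 2 * \<Psi> u \<le> s * \<Psi> u" using s u(2) l by (intro mult_right_mono) auto
    then have "2 \<le> s * \<Psi> u" using u(2) l by simp
    then have "exp (1 - s * \<Psi> u) \<le> exp (- 1)" by simp
    then have "1 - exp (- 1) \<le> prob {\<omega> \<in> space M. 1 / u \<le> S s \<omega>}"
      using subordinator_tail[OF S s0 u(1)] by linarith
    also have "1 / u = (1 / sqrt u)\<^sup>2" using u(1) by (simp add: power_divide)
    finally have "?q \<le> gauss_tail * prob {\<omega> \<in> space M. (1 / sqrt u)\<^sup>2 \<le> S s \<omega>}"
      using gauss_tail_pos by (intro mult_left_mono) auto
    also have "\<dots> \<le> prob {\<omega> \<in> space M. 1 / sqrt u \<le> (\<Sum>i<d. n i * B (S s \<omega>) \<omega> i)}"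
      using u(1) by (intro subordinate_directional_tail[OF XS n _ s0]) simp
    also have "\<dots> \<le> prob {\<omega> \<in> space M. a < Y s \<omega>}"
    proof (rule finite_measure_mono)
      show "{\<omega> \<in> space M. 1 / sqrt u \<le> (\<Sum>i<d. n i * B (S s \<omega>) \<omega> i)} \<subseteq> {\<omega> \<in> space M. a < Y s \<omega>}"
        using a s0 by (auto simp: Y max_absorb2)
      have "Y s \<in> borel_measurable M"
        using measurable_compose[OF measurable_Pair1' Ym, of s] by simp
      then show "{\<omega> \<in> space M. a < Y s \<omega>} \<in> events" by measurable
    qed
    finally show ?thesis .
  qed
  have l0: "0 \<le> 1 / l" using l by simp
  show "integrable M (\<lambda>\<omega>. time_above (\<lambda>s. Y s \<omega>) a (1 / l))"
    by (rule time_above_expectation(1)[OF Ym l0 q])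
  have "(1 - exp (- 1)) * l * (?q * (1 / l / 2))
      \<le> (1 - exp (- 1)) * l * expectation (\<lambda>\<omega>. time_above (\<lambda>s. Y s \<omega>) a (1 / l))"
    using l time_above_expectation(2)[OF Ym l0 q] by (intro mult_left_mono) auto
  also have "(1 - exp (- 1)) * l * (?q * (1 / l / 2)) = killing_gain"
    using l by (simp add: killing_gain_def power2_eq_square)
  finally show "killing_gain \<le> (1 - exp (- 1)) * l * expectation (\<lambda>\<omega>. time_above (\<lambda>s. Y s \<omega>) a (1 / l))" .
qed

text \<open>The Feynman-Kac formula at the maximum over the time span \<open>1 / l\<close>: the
  factor \<open>exp ((v - l) / l)\<close> has to make up for the loss \<open>killing_gain\<close>
  caused by the time spent outside the half-space.\<close>

lemma maximum_near_halfspace_boundary_bound: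
  assumes XS: "subordinate_BM_setup M d \<Psi> S B" and n: "(\<Sum>i<d. (n i)\<^sup>2) = 1"
    and K: "\<And>y. y \<in> K \<Longrightarrow> (\<Sum>i<d. n i * y i) \<le> a"
    and v: "v > 0" and l: "l > 0"
    and \<phi>: "eigenfunction M d S B (\<lambda>y. - v * indicator K y) (- l) \<phi>"
    and x: "x \<in> Rd d" "\<And>y. y \<in> Rd d \<Longrightarrow> cmod (\<phi> y) \<le> cmod (\<phi> x)"
    and u: "u > 0" "\<Psi> u = 4 * l"
    and a: "a - 1 / sqrt u < (\<Sum>i<d. n i * x i)"
  shows "1 \<le> exp ((v - l) / l) * (1 - killing_gain)"
proof -
  have S: "subordinator M \<Psi> S" and B: "brownian M d B"
    using XS by (auto simp: subordinate_BM_setup_def)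
  interpret prob_space M using S by (simp add: subordinator_def)
  define t where "t = 1 / l"
  have t: "t \<ge> 0" "l * t = 1" using l by (auto simp: t_def)
  define Y where "Y = (\<lambda>s \<omega>. (\<Sum>i<d. n i * x i) + (\<Sum>i<d. n i * B (S (max 0 s) \<omega>) \<omega> i))"
  define T where "T = (\<lambda>\<omega>. time_above (\<lambda>s. Y s \<omega>) a t)"
  have T: "integrable M T" "killing_gain \<le> (1 - exp (- 1)) * l * expectation T"
    using time_above_lower_bound[OF XS n u l a Y_def] unfolding T_def t_def by blast+
  note [measurable] = subordinate_directional_measurable[OF XS, of n, unfolded case_prod_beta]
  have Ym: "(\<lambda>(s, \<omega>). Y s \<omega>) \<in> borel_measurable (borel \<Otimes>\<^sub>M M)"
    unfolding Y_def case_prod_beta by measurable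
  have Ys: "(\<lambda>s. Y s \<omega>) \<in> borel_measurable borel" if "\<omega> \<in> space M" for \<omega>
    using measurable_compose[OF measurable_Pair2'[OF that] Ym] by simp
  have T01: "0 \<le> T \<omega>" "T \<omega> \<le> t" if "\<omega> \<in> space M" for \<omega>
    unfolding T_def using time_above_bounds[OF Ys[OF that] t(1)] by auto
  \<comment> \<open>For \<open>v \<ge> l\<close> the exponent \<open>v * T \<omega>\<close> is
    weakened to \<open>l * T \<omega>\<close>, which lies in \<open>{0..1}\<close> as the chord
    bound requires. For \<open>v < l\<close> the trivial bound \<open>1\<close> suffices, since it
    leads to the contradiction \<open>1 \<le> exp ((v - l) / l) < 1\<close>.\<close>
  define G where "G = (\<lambda>\<omega>. exp (v * t) * (if l \<le> v then 1 - (1 - exp (- 1)) * (l * T \<omega>) else 1))"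
  have Gint: "integrable M G" unfolding G_def using T(1) by (cases "l \<le> v") simp_all
  have GT: "exp (v * (t - T \<omega>)) \<le> G \<omega>" if \<omega>: "\<omega> \<in> space M" for \<omega>
  proof -
    have "exp (- (v * T \<omega>)) \<le> (if l \<le> v then 1 - (1 - exp (- 1)) * (l * T \<omega>) else 1)"
    proof (cases "l \<le> v")
      case True
      have "l * T \<omega> \<le> l * t" using T01[OF \<omega>] l by simp
      then have "exp (- (l * T \<omega>)) \<le> 1 - (1 - exp (- 1)) * (l * T \<omega>)"
        using T01[OF \<omega>] l t by (intro exp_neg_le_chord) auto
      moreover have "exp (- (v * T \<omega>)) \<le> exp (- (l * T \<omega>))"
        using True T01[OF \<omega>] by (simp add: mult_right_mono)
      ultimately show ?thesis using True by (simp only: if_True)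
    next
      case False
      then show ?thesis using v T01[OF \<omega>] by simp
    qed
    then have "exp (v * t) * exp (- (v * T \<omega>)) \<le> G \<omega>" unfolding G_def by (rule mult_left_mono) simp
    then show ?thesis by (simp add: right_diff_distrib flip: exp_add)
  qed
  have Rd: "subordinate_BM S B x t \<omega> \<in> Rd d" if "\<omega> \<in> space M" for \<omega>
  proof -
    have "B (S t \<omega>) \<omega> \<in> Rd d"
      using B subordinator_nonneg[OF S that t(1)] that by (simp add: brownian_def)
    then show ?thesis using x(1) by (simp add: Rd_eq subordinate_BM_def)
  qed
  have FK: "exp (- integral {0..t} (\<lambda>s. - v * indicator K (subordinate_BM S B x s \<omega>))) \<le> G \<omega>"
    if \<omega>: "\<omega> \<in> space M" for \<omega>
  proof (rule order_trans[OF _ GT[OF \<omega>]], subst exp_le_cancel_iff)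
    show "- integral {0..t} (\<lambda>s. - v * indicator K (subordinate_BM S B x s \<omega>)) \<le> v * (t - T \<omega>)"
      unfolding T_def
      by (rule feynman_kac_weight_le[OF K _ t(1) _ Ys[OF \<omega>]])
         (use v in \<open>auto simp: Y_def subordinate_BM_def max_absorb2 distrib_left sum.distrib\<close>)
  qed
  have "1 \<le> exp (- l * t) * expectation G"
    by (rule eigenfunction_maximum_bound[OF prob_space_axioms \<phi> x t(1) Rd Gint FK])
  also have "expectation G
      = exp (v * t) * (if l \<le> v then 1 - (1 - exp (- 1)) * (l * expectation T) else 1)"
    unfolding G_def using T(1) by (simp add: prob_space)
  also have "exp (- l * t) * \<dots> = exp ((v - l) / l) *
      (if l \<le> v then 1 - (1 - exp (- 1)) * (l * expectation T) else 1)"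
    by (simp add: t_def diff_divide_distrib mult.assoc[symmetric] flip: exp_add)
  finally have main: "1 \<le> exp ((v - l) / l) *
      (if l \<le> v then 1 - (1 - exp (- 1)) * (l * expectation T) else 1)" .
  have "l \<le> v"
  proof (rule ccontr)
    assume "\<not> l \<le> v"
    then have "exp ((v - l) / l) < 1" using l by (simp add: divide_neg_pos)
    then show False using main \<open>\<not> l \<le> v\<close> by simp
  qed
  then have "1 \<le> exp ((v - l) / l) * (1 - (1 - exp (- 1)) * (l * expectation T))"
    using main by simp
  also have "\<dots> \<le> exp ((v - l) / l) * (1 - killing_gain)"
    using T(2) by (intro mult_left_mono) (auto simp: mult.assoc)
  finally show ?thesis .
qed

theorem theorem4p4:
  fixes \<Psi> :: "real \<Rightarrow> real" and r :: real
  assumes "\<Psi> \<in> bernstein0"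
    and "\<not> bounded (\<Psi> ` {0<..})"
    and "\<And>\<gamma>0. \<gamma>0 > 0 \<Longrightarrow>
           ((\<lambda>s. SUP \<gamma>\<in>{\<gamma>0..}. \<Psi> (s * \<gamma>) / \<Psi> \<gamma>) \<longlongrightarrow> 0) (at_right 0)"
  shows "\<exists>\<rho>1>0. \<exists>\<rho>2>0.
    \<forall>d K (M :: 'w measure) S B v lam \<phi> x.
      d \<ge> 1 \<and>
      K \<subseteq> Rd d \<and> bounded_Rd d K \<and> convex_seq K \<and>
      Euclidean_space d interior_of K \<noteq> {} \<and> inrad d K = r \<and>
      subordinate_BM_setup M d \<Psi> S B \<and>
      v > 0 \<and> lam < 0 \<and>
      eigenfunction M d S B (\<lambda>y. - v * indicator K y) lam \<phi> \<and>
      x \<in> Rd d \<and> (\<forall>y\<in>Rd d. cmod (\<phi> y) \<le> cmod (\<phi> x)) \<and>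
      (v - \<bar>lam\<bar>) / \<bar>lam\<bar> \<le> \<rho>1
      \<longrightarrow>
      x \<in> Euclidean_space d interior_of K \<and>
      dist_boundary d x K \<ge> 1 / sqrt (inv_into {0<..} \<Psi> (\<bar>lam\<bar> / \<rho>2))"
proof -
  \<comment> \<open>Any positive number below \<open>- ln (1 - killing_gain)\<close> makes
    \<open>exp \<rho>1 * (1 - killing_gain)\<close> less than 1; half of it is taken.\<close>
  define \<rho>1 where "\<rho>1 = - ln (1 - killing_gain) / 2"
  have \<rho>1: "\<rho>1 > 0" using killing_gain_bounds by (simp add: \<rho>1_def)
  have "\<rho>1 < - ln (1 - killing_gain)" using \<rho>1 by (simp add: \<rho>1_def)
  then have "exp \<rho>1 < exp (- ln (1 - killing_gain))" by simp
  also have "\<dots> = 1 / (1 - killing_gain)"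
    using killing_gain_bounds by (simp add: exp_minus inverse_eq_divide)
  finally have gain: "exp \<rho>1 * (1 - killing_gain) < 1"
    using killing_gain_bounds by (simp add: field_simps)
  \<comment> \<open>The witness \<open>1 / 4\<close> for \<open>\<rho>2\<close> matches the choice
    \<open>\<Psi> u = 4 * l\<close> in the occupation time estimate.\<close>
  have main: "x \<in> Euclidean_space d interior_of K \<and>
      dist_boundary d x K \<ge> 1 / sqrt (inv_into {0<..} \<Psi> (\<bar>lam\<bar> / (1 / 4)))"
    if d: "d \<ge> 1" and K: "K \<subseteq> Rd d" "bounded_Rd d K" "convex_seq K"
      "Euclidean_space d interior_of K \<noteq> {}"
      and XS: "subordinate_BM_setup M d \<Psi> S B" and v: "v > 0" and lam: "lam < 0"
      and \<phi>: "eigenfunction M d S B (\<lambda>y. - v * indicator K y) lam \<phi>"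
      and x: "x \<in> Rd d" "\<forall>y\<in>Rd d. cmod (\<phi> y) \<le> cmod (\<phi> x)"
      and le: "(v - \<bar>lam\<bar>) / \<bar>lam\<bar> \<le> \<rho>1"
    for d K v lam x and M :: "'w measure" and S B \<phi>
  proof (rule ccontr)
    define u where "u = inv_into {0<..} \<Psi> (\<bar>lam\<bar> / (1 / 4))"
    assume "\<not> ?thesis"
    then have near: "\<not> (x \<in> Euclidean_space d interior_of K \<and> 1 / sqrt u \<le> dist_boundary d x K)"
      by (simp add: u_def)
    have "\<bar>lam\<bar> / (1 / 4) \<in> \<Psi> ` {0<..}"
      using lam by (intro bernstein0_unbounded_surj assms) simp
    then have u: "u > 0" "\<Psi> u = 4 * \<bar>lam\<bar>"
      unfolding u_def using inv_into_into[of _ \<Psi> "{0<..}"] by (auto simp: f_inv_into_f)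
    obtain n a where na: "(\<Sum>i<d. (n i)\<^sup>2) = 1" "\<And>y. y \<in> K \<Longrightarrow> (\<Sum>i<d. n i * y i) \<le> a"
      "a - 1 / sqrt u < (\<Sum>i<d. n i * x i)"
      using halfspace_near_boundary[OF K(3,1,2,4) d x(1) _ near] u(1) by auto
    have "1 \<le> exp ((v - \<bar>lam\<bar>) / \<bar>lam\<bar>) * (1 - killing_gain)"
      by (rule maximum_near_halfspace_boundary_bound[OF XS na(1,2) v _ _ x(1) _ u na(3)])
         (use lam \<phi> x(2) in auto)
    also have "\<dots> \<le> exp \<rho>1 * (1 - killing_gain)"
      using le killing_gain_bounds by (intro mult_right_mono) auto
    finally show False using gain by simp
  qed
  show ?thesis
    by (rule exI[of _ \<rho>1], rule conjI[OF \<rho>1], rule exI[of _ "1 / 4"], rule conjI, simp)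
       (intro allI impI, elim conjE, rule main)
qed

end
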